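(* Let $\Omega \subset \mathbb{R}^d$ be a bounded domain, let $D \subset \partial\Omega$ be a closed part of the boundary and let $p \in (1,\infty)$. Suppose that the following three conditions are satisfied. (i) The set $D$ is $l$-thick for some $l \in (d-p,d]$. (ii) The space $W^{1,p}_D(\Omega)$ can be equivalently normed by $\|\nabla \cdot\|_{L^p(\Omega)}$. (iii) There is a linear continuous extension operator $\mathfrak{E} : W^{1,p}_D(\Omega) \to W^{1,p}_D(\mathbb{R}^d)$. Then there is a constant $c>0$ such that Hardy's inequality $$\int_\Omega \left| \frac{u}{\operatorname{dist}_D} \right|^p \, d\mathrm{x} \le c \int_\Omega |\nabla u|^p \, d\mathrm{x}$$ holds for all $u \in W^{1,p}_D(\Omega)$.
   Context: The space dimension is $d \ge 1$; a domain is a non-empty connected open set; $B(\mathrm{x},r)$ is the open ball; $\operatorname{dist}_D$ is the Euclidean distance function to $D$. For $\Lambda \subset \mathbb{R}^d$ open, $E \subset \overline{\Lambda}$ closed and $p \in [1,\infty)$, put $C^\infty_E(\Lambda) := \{ v|_\Lambda : v \in C_0^\infty(\mathbb{R}^d),\ \operatorname{supp}(v) \cap E = \emptyset \}$, and let $W^{1,p}_E(\Lambda)$ be the completion of $C^\infty_E(\Lambda)$ with respect to the norm $v \mapsto \big( \int_\Lambda |\nabla v|^p + |v|^p \, d\mathrm{x} \big)^{1/p}$. An extension operator $\mathfrak{E}$ is one with $(\mathfrak{E}u)|_\Omega = u$ a.e. for all $u$ in its domain. For $l>0$ the centered Hausdorff content of $F \subset \mathbb{R}^d$ is $\mathcal{H}_l^\infty(F)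 := \inf \{ \sum_{j=1}^\infty r_j^l : \mathrm{x}_j \in F,\ r_j>0,\ F \subset \bigcup_{j=1}^\infty B(\mathrm{x}_j,r_j) \}$. For $l \in (0,\infty)$, a non-empty compact set $F \subset \mathbb{R}^d$ is called $l$-thick if there exist $R>0$ and $\gamma>0$ such that $\mathcal{H}^\infty_l(F \cap B(\mathrm{x},r)) \ge \gamma r^l$ for all $\mathrm{x} \in F$ and all $r \in (0,R]$. ($l$-thickness is defined only for $l>0$.) *)

theory Defs
  imports "HOL-Analysis.Analysis"
begin

text \<open>
  Functions take values in a type \<open>'k\<close> of class \<open>{real_normed_field, euclidean_space}\<close>.
  The real and the complex numbers are both instances, and up to isomorphism the only ones,
  so real- and complex-valued function spaces are treated at once.  The gradient of a
  \<open>'k\<close>-valued function on \<open>real^'n\<close> is a \<open>'k^'n\<close>-valued function, measured in the Euclidean norm.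
\<close>

definition partial_deriv ::
  "'n \<Rightarrow> (real^'n \<Rightarrow> 'k::{real_normed_field,euclidean_space}) \<Rightarrow> real^'n \<Rightarrow> 'k" where
  "partial_deriv i v x = frechet_derivative v (at x) (axis i 1)"

definition grad ::
  "(real^'n \<Rightarrow> 'k::{real_normed_field,euclidean_space}) \<Rightarrow> real^'n \<Rightarrow> 'k^'n" where
  "grad v x = (\<chi> i. partial_deriv i v x)"

primrec Ck ::
  "nat \<Rightarrow> (real^'n \<Rightarrow> 'k::{real_normed_field,euclidean_space}) \<Rightarrow> bool" where
  "Ck 0 v \<longleftrightarrow> continuous_on UNIV v"
| "Ck (Suc k) v \<longleftrightarrow> (\<forall>x. v differentiable (at x)) \<and> (\<forall>i. Ck k (partial_deriv i v))"

definition supp :: "(real^'n \<Rightarrow> 'k::{real_normed_field,euclidean_space}) \<Rightarrow> (real^'n) set" where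
  "supp v = closure {x. v x \<noteq> 0}"

text \<open>
  The functions whose restrictions to \<open>\<Lambda>\<close> form $C^\infty_E(\Lambda)$.  The restriction itself is not
  part of the definition: below, such functions are only looked at on \<open>\<Lambda>\<close>.
\<close>

definition test_functions ::
  "(real^'n) set \<Rightarrow> (real^'n \<Rightarrow> 'k::{real_normed_field,euclidean_space}) set" where
  "test_functions E = {v. (\<forall>k. Ck k v) \<and> compact (supp v) \<and> supp v \<inter> E = {}}"

definition Lp_norm ::
  "real \<Rightarrow> (real^'n) set \<Rightarrow> (real^'n \<Rightarrow> 'b::euclidean_space) \<Rightarrow> real" where
  "Lp_norm p \<Lambda> f = (LINT x|lebesgue_on \<Lambda>. norm (f x) powr p) powr (1 / p)"

definition in_Lp ::
  "real \<Rightarrow> (real^'n) set \<Rightarrow> (real^'n \<Rightarrow> 'b::euclidean_space) \<Rightarrow> bool" where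
  "in_Lp p \<Lambda> f \<longleftrightarrow> f \<in> borel_measurable (lebesgue_on \<Lambda>) \<and>
     integrable (lebesgue_on \<Lambda>) (\<lambda>x. norm (f x) powr p)"

text \<open>The Sobolev norm of \<open>u\<close>, where \<open>G\<close> is the gradient of \<open>u\<close>.\<close>

definition W1p_norm ::
  "real \<Rightarrow> (real^'n) set \<Rightarrow> (real^'n \<Rightarrow> 'k::{real_normed_field,euclidean_space}) \<Rightarrow>
    (real^'n \<Rightarrow> 'k^'n) \<Rightarrow> real" where
  "W1p_norm p \<Lambda> u G =
     (LINT x|lebesgue_on \<Lambda>. norm (G x) powr p + norm (u x) powr p) powr (1 / p)"

text \<open>
  \<open>W1p E \<Lambda> p u G\<close> says that \<open>u\<close> belongs to $W^{1,p}_E(\Lambda)$ and that $\nabla u$ is \<open>G\<close>.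
  The map sending \<open>v\<close> to the pair of \<open>v\<close> and \<open>grad v\<close> embeds $C^\infty_E(\Lambda)$ isometrically into the
  complete space of pairs of $L^p(\Lambda)$ functions, so the completion is the closure of its image.
  As usual, \<open>u\<close> and \<open>G\<close> are representatives of their classes modulo equality almost everywhere
  on \<open>\<Lambda>\<close>, and their values off \<open>\<Lambda>\<close> are irrelevant.
\<close>

definition W1p ::
  "(real^'n) set \<Rightarrow> (real^'n) set \<Rightarrow> real \<Rightarrow>
    (real^'n \<Rightarrow> 'k::{real_normed_field,euclidean_space}) \<Rightarrow> (real^'n \<Rightarrow> 'k^'n) \<Rightarrow> bool" where
  "W1p E \<Lambda> p u G \<longleftrightarrow> in_Lp p \<Lambda> u \<and> in_Lp p \<Lambda> G \<and>
     (\<exists>v. (\<forall>n::nat. v n \<in> test_functions E) \<and>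
        (\<lambda>n. W1p_norm p \<Lambda> (\<lambda>x. v n x - u x) (\<lambda>x. grad (v n) x - G x)) \<longlonglongrightarrow> 0)"

text \<open>
  The first three conditions together express that \<open>T\<close> is a linear map between the
  spaces of classes modulo equality almost everywhere.
\<close>

definition extension_operator ::
  "(real^'n) set \<Rightarrow> (real^'n) set \<Rightarrow> real \<Rightarrow>
    ((real^'n \<Rightarrow> 'k::{real_normed_field,euclidean_space}) \<Rightarrow> (real^'n \<Rightarrow> 'k)) \<Rightarrow> bool" where
  "extension_operator D \<Omega> p T \<longleftrightarrow>
     (\<forall>u G. W1p D \<Omega> p u G \<longrightarrow> (\<exists>H. W1p D UNIV p (T u) H)) \<and>
     (\<forall>u G v H. W1p D \<Omega> p u G \<and> W1p D \<Omega> p v H \<and> (AE x in lebesgue_on \<Omega>. u x = v x) \<longrightarrow>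
        (AE x in lebesgue. T u x = T v x)) \<and>
     (\<forall>u G v H a b. W1p D \<Omega> p u G \<and> W1p D \<Omega> p v H \<longrightarrow>
        (AE x in lebesgue. T (\<lambda>y. a * u y + b * v y) x = a * T u x + b * T v x)) \<and>
     (\<exists>C. \<forall>u G H. W1p D \<Omega> p u G \<and> W1p D UNIV p (T u) H \<longrightarrow>
        W1p_norm p UNIV (T u) H \<le> C * W1p_norm p \<Omega> u G) \<and>
     (\<forall>u G. W1p D \<Omega> p u G \<longrightarrow> (AE x in lebesgue_on \<Omega>. T u x = u x))"

definition hausdorff_content :: "real \<Rightarrow> (real^'n) set \<Rightarrow> ennreal" where
  "hausdorff_content l F =
     Inf {(\<Sum>j. ennreal (r j powr l)) | (x :: nat \<Rightarrow> real^'n) (r :: nat \<Rightarrow> real).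
       (\<forall>j. x j \<in> F \<and> r j > 0) \<and> F \<subseteq> (\<Union>j. ball (x j) (r j))}"

definition thick :: "real \<Rightarrow> (real^'n) set \<Rightarrow> bool" where
  "thick l F \<longleftrightarrow> l > 0 \<and> F \<noteq> {} \<and> compact F \<and>
     (\<exists>R>0. \<exists>\<gamma>>0. \<forall>x\<in>F. \<forall>r\<in>{0<..R}.
        hausdorff_content l (F \<inter> ball x r) \<ge> ennreal (\<gamma> * r powr l))"

end

theory Submission
  imports Defs
begin

text \<open>
Write \<open>\<delta>\<close> for the distance to \<open>D\<close> and \<open>d\<close> for the dimension. The extension operator and the
equivalence of norms reduce the claim to the whole space, where it reads
\<open>\<integral> (|u| / \<delta>)^p \<le> K \<integral> (|\<nabla>u|^p + |u|^p)\<close>; by density and Fatou's lemma it is enough to treat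
test functions \<open>v\<close> that vanish near \<open>D\<close> (\<open>hardy_test_functions\<close>, \<open>hardy_W1p_whole_space\<close>).

The geometric input is a Poincare inequality at points of \<open>D\<close> (\<open>thick_poincare\<close>): if \<open>w\<close> vanishes
on \<open>D\<close>, then for small \<open>\<rho>\<close> and every \<open>z \<in> D\<close> the integral of \<open>|w|^p\<close> over a ball of radius \<open>2\<rho>\<close>
about \<open>z\<close> is at most \<open>C \<rho>^p\<close> times that of \<open>|\<nabla>w|^p\<close>. The reason is a capacity argument. Suppose
the average of \<open>w\<close> over every ball of radius \<open>\<rho>\<close> about a point \<open>y\<close> of \<open>D\<close> near \<open>z\<close> has size at
least \<open>m\<close>. As these averages tend to \<open>w y = 0\<close> when the radius is halved repeatedly, at some scale
\<open>r\<close> consecutive averages differ by much, and the ordinary Poincare inequality makes the integral of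
\<open>|\<nabla>w|^p\<close> over the ball of radius \<open>r\<close> about \<open>y\<close> at least a constant times \<open>m^p r^l \<rho>^(d - p - l)\<close>;
this is where \<open>l > d - p\<close> enters. A Vitali covering by such balls shows that \<open>m^p\<close> times the content
of \<open>D\<close> near \<open>z\<close> is controlled by the integral of \<open>|\<nabla>w|^p\<close>, and thickness bounds the content from
below.

Averaging over the centre turns this into
\<open>\<integral>\<^bsub>\<delta> < \<rho>/2\<^esub> |w|^p \<le> C \<rho>^p \<integral>\<^bsub>\<delta> < 4\<rho>\<^esub> |\<nabla>w|^p\<close> (\<open>neighbourhood_estimate\<close>). Summing over dyadic \<open>\<rho>\<close>
without a weight would lose a logarithm, because a point \<open>x\<close> occurs on the right for all scales above
\<open>\<delta> x / 4\<close>. With the extra weight \<open>\<rho>^(- p - b)\<close>, \<open>b > 0\<close>, the sum is geometric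
(\<open>weighted_estimate\<close>):
\<open>\<integral> |w|^p \<delta>^(- p - b) \<le> (C / b) \<integral> |\<nabla>w|^p \<delta>^(- b)\<close> close to \<open>D\<close>. Now insert \<open>w = |v| \<delta>^(b/p)\<close>. The weights
cancel, and the derivative of \<open>\<delta>^(b/p)\<close> contributes only \<open>C b^(p - 1) \<integral> (|v| / \<delta>)^p\<close> on the right.
Since \<open>p > 1\<close>, this is absorbed into the left side for small \<open>b\<close> (\<open>hardy_locally_lipschitz\<close>).

The function \<open>\<delta>\<close> is only Lipschitz, so gradients are replaced by upper gradients throughout:
a continuous \<open>g\<close> whose integrals along segments bound the increments of \<open>w\<close>.
\<close>

section \<open>Jensen's inequality on sets of finite measure\<close>

lemma powr_above_tangent:
  fixes a t p :: real
  assumes "1 \<le> p" "0 < a" "0 \<le> t"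
  shows "a powr p + p * a powr (p - 1) * (t - a) \<le> t powr p"
proof (cases "t = 0")
  case True
  have "a powr (p - 1) * a = a powr p"
    using assms by (simp add: powr_diff)
  then show ?thesis
    using True assms by (simp add: algebra_simps mult_left_le)
next
  case False
  have "p * a powr (p - 1) * (t - a) \<le> t powr p - a powr p"
  proof (rule convex_on_imp_above_tangent[where A = "{0<..}"])
    show "convex_on {0<..} (\<lambda>x. x powr p)" using assms by (intro powr_convex)
    show "((\<lambda>x. x powr p) has_real_derivative p * a powr (p - 1)) (at a within {0<..})"
      using has_real_derivative_powr[OF assms(2)] by (rule has_field_derivative_at_within)
  qed (use assms False in \<open>auto simp: interior_open\<close>)
  then show ?thesis by simp
qed

text \<open>
Jensen's inequality for \<open>t \<mapsto> t powr p\<close>: integrate the tangent inequality for \<open>|f|\<close> at the point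
\<open>a = |I| / m\<close>, where \<open>I\<close> is the integral of \<open>f\<close> and \<open>m\<close> the measure of \<open>S\<close>; the mean of \<open>|f|\<close> is at least
\<open>a\<close>, so the linear term is nonnegative. The right side is an extended integral because \<open>|f|^p\<close> may
fail to be integrable.
\<close>

lemma set_integral_powr_le:
  fixes f :: "'a \<Rightarrow> real"
  assumes p: "1 \<le> p" and f: "set_integrable M S f"
    and S: "S \<in> sets M" "emeasure M S < \<infinity>"
  shows "ennreal (\<bar>LINT x:S|M. f x\<bar> powr p)
    \<le> ennreal (measure M S powr (p - 1)) * (\<integral>\<^sup>+x\<in>S. ennreal (\<bar>f x\<bar> powr p) \<partial>M)"
proof -
  define I where "I = (LINT x:S|M. f x)"
  define m where "m = measure M S"
  define a where "a = \<bar>I\<bar> / m"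
  have fS: "(\<lambda>x. indicat_real S x * f x) \<in> borel_measurable M"
    using f unfolding set_integrable_def by (simp add: borel_measurable_integrable)
  have eq: "\<bar>f x\<bar> powr p * indicat_real S x = \<bar>indicat_real S x * f x\<bar> powr p" for x
    using p by (auto simp: indicator_def)
  have meas: "(\<lambda>x. \<bar>f x\<bar> powr p * indicat_real S x) \<in> borel_measurable M"
    unfolding eq using fS by measurable
  have nn: "(\<integral>\<^sup>+x\<in>S. ennreal (\<bar>f x\<bar> powr p) \<partial>M)
      = (\<integral>\<^sup>+x. ennreal (\<bar>f x\<bar> powr p * indicat_real S x) \<partial>M)"
    by (intro nn_integral_cong) (auto simp: indicator_def)
  show ?thesis
  proof (cases "I = 0 \<or> (\<integral>\<^sup>+x\<in>S. ennreal (\<bar>f x\<bar> powr p) \<partial>M) = \<infinity> \<or> m = 0")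
    case True
    moreover have "I = 0" if "m = 0"
    proof -
      have "S \<in> null_sets M"
        using that S by (auto simp: m_def measure_def enn2real_eq_0_iff)
      then have "AE x in M. x \<notin> S"
        by (rule AE_not_in)
      then have "AE x in M. indicat_real S x *\<^sub>R f x = 0"
        by eventually_elim simp
      then show ?thesis
        unfolding I_def set_lebesgue_integral_def by (rule integral_eq_zero_AE)
    qed
    moreover have "?thesis" if "(\<integral>\<^sup>+x\<in>S. ennreal (\<bar>f x\<bar> powr p) \<partial>M) = \<infinity>" "m \<noteq> 0"
    proof -
      have "ennreal (m powr (p - 1)) \<noteq> 0" using that(2) by (simp add: m_def)
      then show ?thesis using that(1) by (simp add: m_def ennreal_mult_top)
    qed
    ultimately show ?thesis using p by (cases "m = 0") (auto simp: I_def)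
  next
    case False
    have m: "m > 0" using False by (simp add: m_def zero_less_measure_iff)
    have a: "a > 0" using False m by (simp add: a_def)
    have int: "integrable M (\<lambda>x. \<bar>f x\<bar> powr p * indicat_real S x)"
      using False nn meas by (intro integrableI_nonneg) (auto simp: less_top)
    have abs: "integrable M (\<lambda>x. \<bar>f x\<bar> * indicat_real S x)"
      using f[unfolded set_integrable_def, THEN integrable_abs] by (simp add: abs_mult mult.commute)
    have one: "integrable M (indicat_real S)" using S by simp
    have "(LINT x|M. (a powr p - p * a powr (p - 1) * a) * indicat_real S x
             + p * a powr (p - 1) * (\<bar>f x\<bar> * indicat_real S x))
          \<le> (LINT x|M. \<bar>f x\<bar> powr p * indicat_real S x)"
    proof (intro integral_mono Bochner_Integration.integrable_add integrable_mult_right one abs int)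
      fix x
      show "(a powr p - p * a powr (p - 1) * a) * indicat_real S x
             + p * a powr (p - 1) * (\<bar>f x\<bar> * indicat_real S x) \<le> \<bar>f x\<bar> powr p * indicat_real S x"
        using powr_above_tangent[OF p a, of "\<bar>f x\<bar>"] by (auto simp: indicator_def algebra_simps)
    qed
    also have "(LINT x|M. (a powr p - p * a powr (p - 1) * a) * indicat_real S x
             + p * a powr (p - 1) * (\<bar>f x\<bar> * indicat_real S x))
       = (a powr p - p * a powr (p - 1) * a) * m
         + p * a powr (p - 1) * (LINT x|M. \<bar>f x\<bar> * indicat_real S x)"
      using abs one S by (simp add: m_def)
    finally have 1: "a powr p * m + p * a powr (p - 1) * ((LINT x|M. \<bar>f x\<bar> * indicat_real S x) - a * m)
        \<le> (LINT x|M. \<bar>f x\<bar> powr p * indicat_real S x)"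
      by (simp add: algebra_simps)
    have "\<bar>I\<bar> \<le> (LINT x|M. \<bar>f x\<bar> * indicat_real S x)"
      using integral_abs_bound[of M "\<lambda>x. indicat_real S x * f x"]
      by (simp add: I_def set_lebesgue_integral_def abs_mult mult.commute)
    then have "a * m \<le> (LINT x|M. \<bar>f x\<bar> * indicat_real S x)"
      using m by (simp add: a_def)
    then have "0 \<le> p * a powr (p - 1) * ((LINT x|M. \<bar>f x\<bar> * indicat_real S x) - a * m)"
      using p a by simp
    with 1 have 2: "a powr p * m \<le> (LINT x|M. \<bar>f x\<bar> powr p * indicat_real S x)" by linarith
    have "\<bar>I\<bar> powr p = m powr (p - 1) * (a powr p * m)"
      using m by (simp add: a_def powr_divide powr_diff)
    also have "\<dots> \<le> m powr (p - 1) * (LINT x|M. \<bar>f x\<bar> powr p * indicat_real S x)"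
      using 2 by (intro mult_left_mono) auto
    finally have "ennreal (\<bar>I\<bar> powr p) \<le> ennreal (m powr (p - 1)) * ennreal (LINT x|M. \<bar>f x\<bar> powr p * indicat_real S x)"
      by (simp add: ennreal_mult'[symmetric] ennreal_leI)
    also have "ennreal (LINT x|M. \<bar>f x\<bar> powr p * indicat_real S x) = (\<integral>\<^sup>+x\<in>S. ennreal (\<bar>f x\<bar> powr p) \<partial>M)"
      unfolding nn using int by (subst nn_integral_eq_integral) auto
    finally show ?thesis by (simp add: I_def m_def)
  qed
qed

section \<open>Upper gradients and the Poincare inequality on balls\<close>

lemma nn_integral_lborel_affine:
  fixes F :: "'a::euclidean_space \<Rightarrow> ennreal"
  assumes [measurable]: "F \<in> borel_measurable borel" and "c \<noteq> 0"
  shows "(\<integral>\<^sup>+x. F x \<partial>lborel) = ennreal (\<bar>c\<bar> ^ DIM('a)) * (\<integral>\<^sup>+x. F (b + c *\<^sub>R x) \<partial>lborel)"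
proof -
  have "(\<integral>\<^sup>+x. F x \<partial>lborel) = (\<integral>\<^sup>+x. F x \<partial>density (distr lborel borel (\<lambda>x. b + c *\<^sub>R x)) (\<lambda>_. ennreal (\<bar>c\<bar> ^ DIM('a))))"
    using lborel_affine[OF \<open>c \<noteq> 0\<close>, of b] by simp
  also have "\<dots> = (\<integral>\<^sup>+x. ennreal (\<bar>c\<bar> ^ DIM('a)) * F (b + c *\<^sub>R x) \<partial>lborel)"
    by (subst nn_integral_density) (auto simp: nn_integral_distr)
  also have "\<dots> = ennreal (\<bar>c\<bar> ^ DIM('a)) * (\<integral>\<^sup>+x. F (b + c *\<^sub>R x) \<partial>lborel)"
    by (rule nn_integral_cmult) measurable
  finally show ?thesis .
qed

text \<open>
For a \<open>C^1\<close> function \<open>w\<close> this holds with \<open>g\<close> the norm of the gradient. The notion is stable under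
multiplication by powers of a Lipschitz function, which need not be differentiable.
\<close>

definition upper_gradient :: "('a::euclidean_space \<Rightarrow> real) \<Rightarrow> ('a \<Rightarrow> real) \<Rightarrow> bool" where
  "upper_gradient w g \<longleftrightarrow> continuous_on UNIV w \<and> continuous_on UNIV g \<and> (\<forall>x. 0 \<le> g x) \<and>
     (\<forall>x y. \<bar>w y - w x\<bar> \<le> norm (y - x) * integral {0..1} (\<lambda>t. g (x + t *\<^sub>R (y - x))))"

lemma upper_gradient_powr:
  fixes w g :: "'a::euclidean_space \<Rightarrow> real"
  assumes ug: "upper_gradient w g" and p: "1 \<le> p"
  shows "ennreal (\<bar>w y - w x\<bar> powr p)
    \<le> ennreal (norm (y - x) powr p) * (\<integral>\<^sup>+t\<in>{0..1}. ennreal (g (x + t *\<^sub>R (y - x)) powr p) \<partial>lborel)"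
proof -
  let ?h = "\<lambda>t::real. g (x + t *\<^sub>R (y - x))"
  have h: "continuous_on {0..1} ?h"
    using ug unfolding upper_gradient_def
    by (intro continuous_on_compose2[of UNIV g "{0..1}" "\<lambda>t. x + t *\<^sub>R (y - x)"] continuous_intros) auto
  then have si: "set_integrable lborel {0..1} ?h"
    by (rule borel_integrable_atLeastAtMost')
  then have eq: "integral {0..1} ?h = (LINT t:{0..1}|lborel. ?h t)"
    using set_borel_integral_eq_integral(2) by metis
  have g0: "0 \<le> g z" for z using ug by (simp add: upper_gradient_def)
  have "\<bar>w y - w x\<bar> powr p \<le> (norm (y - x) * \<bar>LINT t:{0..1}|lborel. ?h t\<bar>) powr p"
  proof (rule powr_mono2)
    have "\<bar>w y - w x\<bar> \<le> norm (y - x) * (LINT t:{0..1}|lborel. ?h t)"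
      using ug unfolding upper_gradient_def eq[symmetric] by blast
    also have "\<dots> \<le> norm (y - x) * \<bar>LINT t:{0..1}|lborel. ?h t\<bar>"
      by (intro mult_left_mono) auto
    finally show "\<bar>w y - w x\<bar> \<le> norm (y - x) * \<bar>LINT t:{0..1}|lborel. ?h t\<bar>" .
  qed (use p in auto)
  also have "\<dots> = norm (y - x) powr p * \<bar>LINT t:{0..1}|lborel. ?h t\<bar> powr p"
    by (simp add: powr_mult)
  finally have "ennreal (\<bar>w y - w x\<bar> powr p)
      \<le> ennreal (norm (y - x) powr p) * ennreal (\<bar>LINT t:{0..1}|lborel. ?h t\<bar> powr p)"
    by (simp add: ennreal_mult'[symmetric] ennreal_leI)
  also have "ennreal (\<bar>LINT t:{0..1}|lborel. ?h t\<bar> powr p)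
      \<le> (\<integral>\<^sup>+t\<in>{0..1}. ennreal (\<bar>?h t\<bar> powr p) \<partial>lborel)"
    using set_integral_powr_le[OF p si] by simp
  finally show ?thesis using g0 by (simp add: mult_left_mono)
qed

lemma nn_integral_contract_le:
  fixes F :: "'a::euclidean_space \<Rightarrow> ennreal"
  assumes "F \<in> borel_measurable borel" and "1/2 \<le> c"
  shows "(\<integral>\<^sup>+x. F (b + c *\<^sub>R x) \<partial>lborel) \<le> ennreal (2 ^ DIM('a)) * (\<integral>\<^sup>+x. F x \<partial>lborel)"
proof -
  have "1 \<le> ennreal (2 ^ DIM('a)) * ennreal (\<bar>c\<bar> ^ DIM('a))"
  proof -
    have "(1::real) \<le> (2 * \<bar>c\<bar>) ^ DIM('a)" using assms by (intro one_le_power) auto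
    then show ?thesis 
      by (metis ennreal_1 ennreal_leI ennreal_mult' power_mult_distrib zero_le_numeral zero_le_power)
  qed
  then have "1 * (\<integral>\<^sup>+x. F (b + c *\<^sub>R x) \<partial>lborel)
      \<le> ennreal (2 ^ DIM('a)) * ennreal (\<bar>c\<bar> ^ DIM('a)) * (\<integral>\<^sup>+x. F (b + c *\<^sub>R x) \<partial>lborel)"
    by (rule mult_right_mono) simp
  also have "\<dots> = ennreal (2 ^ DIM('a)) * (\<integral>\<^sup>+x. F x \<partial>lborel)"
    using nn_integral_lborel_affine[of F c b] assms by (simp add: mult.assoc)
  finally show ?thesis by simp
qed

text \<open>
The Poincare inequality in its form with two integrals. The increment of \<open>w\<close> between \<open>x\<close> and \<open>y\<close>
is bounded by the integral of \<open>g\<close> at \<open>(1 - t) x + t y\<close>. For \<open>t \<le> 1/2\<close> the substitution is made in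
the variable \<open>x\<close>, otherwise in \<open>y\<close>; in both cases the affine map contracts by a factor of at least
\<open>1/2\<close>, so that the Jacobian is at most \<open>2^d\<close>.
\<close>

lemma double_poincare:
  fixes w g :: "'a::euclidean_space \<Rightarrow> real"
  assumes ug: "upper_gradient w g" and p: "1 \<le> p" and r: "0 \<le> r"
  shows "(\<integral>\<^sup>+x\<in>ball z r. (\<integral>\<^sup>+y\<in>ball z r. ennreal (\<bar>w y - w x\<bar> powr p) \<partial>lborel) \<partial>lborel)
    \<le> ennreal ((2 * r) powr p * 2 ^ DIM('a)) * emeasure lborel (ball z r) *
       (\<integral>\<^sup>+x\<in>ball z r. ennreal (g x powr p) \<partial>lborel)"
proof -
  define K where "K = ball z r"
  let ?I = "\<integral>\<^sup>+x\<in>K. ennreal (g x powr p) \<partial>lborel"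
  have K[measurable]: "K \<in> sets borel" by (simp add: K_def)
  define F where "F = (\<lambda>u. ennreal (g u powr p) * indicator K u)"
  have [measurable]: "g \<in> borel_measurable borel"
    using ug by (auto simp: upper_gradient_def intro: borel_measurable_continuous_onI)
  have F[measurable]: "F \<in> borel_measurable borel"
    unfolding F_def by measurable
  have half: "(\<integral>\<^sup>+y\<in>K. (\<integral>\<^sup>+t\<in>{0..1/2}. (\<integral>\<^sup>+x. F (t *\<^sub>R y + (1 - t) *\<^sub>R x) \<partial>lborel) \<partial>lborel) \<partial>lborel)
      \<le> ennreal (2 ^ DIM('a)) * ennreal (1/2) * emeasure lborel K * ?I"
  proof -
    have "(\<integral>\<^sup>+t\<in>{0..1/2}. (\<integral>\<^sup>+x. F (t *\<^sub>R y + (1 - t) *\<^sub>R x) \<partial>lborel) \<partial>lborel)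
        \<le> ennreal (2 ^ DIM('a)) * ennreal (1/2) * ?I" for y
    proof -
      have "(\<integral>\<^sup>+t\<in>{0..1/2}. (\<integral>\<^sup>+x. F (t *\<^sub>R y + (1 - t) *\<^sub>R x) \<partial>lborel) \<partial>lborel)
          \<le> (\<integral>\<^sup>+t\<in>{0..1/2::real}. (ennreal (2 ^ DIM('a)) * ?I) \<partial>lborel)"
      proof (rule nn_integral_mono)
        fix t :: real
        show "(\<integral>\<^sup>+x. F (t *\<^sub>R y + (1 - t) *\<^sub>R x) \<partial>lborel) * indicator {0..1/2} t
          \<le> ennreal (2 ^ DIM('a)) * ?I * indicator {0..1/2} t"
          using nn_integral_contract_le[OF F, of "1 - t" "t *\<^sub>R y"]
          by (auto simp: indicator_def F_def)
      qed
      also have "\<dots> = ennreal (2 ^ DIM('a)) * ennreal (1/2) * ?I"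
        by (subst nn_integral_cmult_indicator) (auto simp: mult_ac divide_ennreal_def)
      finally show ?thesis .
    qed
    then have "(\<integral>\<^sup>+y\<in>K. (\<integral>\<^sup>+t\<in>{0..1/2}. (\<integral>\<^sup>+x. F (t *\<^sub>R y + (1 - t) *\<^sub>R x) \<partial>lborel) \<partial>lborel) \<partial>lborel)
      \<le> (\<integral>\<^sup>+y\<in>K. (ennreal (2 ^ DIM('a)) * ennreal (1/2) * ?I) \<partial>lborel)"
      by (intro nn_integral_mono mult_right_mono) auto
    also have "\<dots> = ennreal (2 ^ DIM('a)) * ennreal (1/2) * emeasure lborel K * ?I"
      by (subst nn_integral_cmult_indicator) (auto simp: mult_ac)
    finally show ?thesis .
  qed
  define P where "P = (\<lambda>x y. \<integral>\<^sup>+t\<in>{0..1/2}. F (t *\<^sub>R y + (1 - t) *\<^sub>R x) \<partial>lborel)"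
  have P[measurable]: "(\<lambda>(x, y). P x y) \<in> borel_measurable (borel \<Otimes>\<^sub>M borel)"
    unfolding P_def by measurable
  \<comment> \<open>The halves \<open>t \<le> 1/2\<close> and \<open>t \<ge> 1/2\<close> are exchanged by swapping \<open>x\<close> and \<open>y\<close>, so both give the same double integral.\<close>
  define S where "S = (\<integral>\<^sup>+y. \<integral>\<^sup>+x. P x y * indicator K x * indicator K y \<partial>lborel \<partial>lborel)"
  have S': "S = (\<integral>\<^sup>+x. \<integral>\<^sup>+y. P x y * indicator K x * indicator K y \<partial>lborel \<partial>lborel)"
    unfolding S_def by (rule lborel_pair.Fubini') measurable
  have S_le: "S \<le> ennreal (2 ^ DIM('a)) * ennreal (1/2) * emeasure lborel K * ?I"
  proof -
    have eq: "(\<integral>\<^sup>+x. P x y \<partial>lborel)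
        = (\<integral>\<^sup>+t\<in>{0..1/2}. (\<integral>\<^sup>+x. F (t *\<^sub>R y + (1 - t) *\<^sub>R x) \<partial>lborel) \<partial>lborel)" for y
    proof -
      have "(\<integral>\<^sup>+x. P x y \<partial>lborel)
        = (\<integral>\<^sup>+t. (\<integral>\<^sup>+x. F (t *\<^sub>R y + (1 - t) *\<^sub>R x) * indicator {0..1/2} t \<partial>lborel) \<partial>lborel)"
        unfolding P_def by (rule lborel_pair.Fubini'[symmetric]) measurable
      then show ?thesis by (simp add: nn_integral_multc)
    qed
    have "S \<le> (\<integral>\<^sup>+y. (\<integral>\<^sup>+x. P x y \<partial>lborel) * indicator K y \<partial>lborel)"
      unfolding S_def
      by (intro nn_integral_mono) (auto simp: indicator_def intro!: nn_integral_mono)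
    also have "\<dots> \<le> ennreal (2 ^ DIM('a)) * ennreal (1/2) * emeasure lborel K * ?I"
      using half by (simp only: eq)
    finally show ?thesis .
  qed
  have "ennreal (\<bar>w y - w x\<bar> powr p) \<le> ennreal ((2*r) powr p) *
      (P x y + P y x)" if x: "x \<in> K" and y: "y \<in> K" for x y
  proof -
    have "norm (y - x) \<le> 2 * r"
      using x y dist_triangle2[of y x z] by (simp add: K_def dist_norm norm_minus_commute)
    then have 1: "norm (y - x) powr p \<le> (2 * r) powr p" using p by (intro powr_mono2) auto
    have 2: "(\<integral>\<^sup>+t\<in>{0..1}. ennreal (g (x + t *\<^sub>R (y - x)) powr p) \<partial>lborel)
      \<le> (\<integral>\<^sup>+t. F (t *\<^sub>R y + (1 - t) *\<^sub>R x) * indicator {0..1/2} t + F (t *\<^sub>R y + (1 - t) *\<^sub>R x) * indicator {1/2..1} t \<partial>lborel)"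
    proof (rule nn_integral_mono)
      fix t :: real
      have e: "x + t *\<^sub>R (y - x) = t *\<^sub>R y + (1 - t) *\<^sub>R x" by (simp add: algebra_simps)
      have "t *\<^sub>R y + (1 - t) *\<^sub>R x \<in> K" if "0 \<le> t" "t \<le> 1"
        using convex_ball[of z r, folded K_def, unfolded convex_alt, rule_format, OF x y, of t] that
        by (simp add: add.commute)
      then show "ennreal (g (x + t *\<^sub>R (y - x)) powr p) * indicator {0..1} t
        \<le> F (t *\<^sub>R y + (1 - t) *\<^sub>R x) * indicator {0..1/2} t + F (t *\<^sub>R y + (1 - t) *\<^sub>R x) * indicator {1/2..1} t"
        unfolding e F_def by (auto simp: indicator_def)
    qed
    have 3: "(\<integral>\<^sup>+t\<in>{1/2..1}. F (t *\<^sub>R y + (1 - t) *\<^sub>R x) \<partial>lborel) = (\<integral>\<^sup>+t\<in>{0..1/2}. F (t *\<^sub>R x + (1 - t) *\<^sub>R y) \<partial>lborel)"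
      by (subst nn_integral_lborel_affine[where c = "-1" and b = 1])
         (auto intro!: nn_integral_cong simp: indicator_def add.commute)
    have "ennreal (\<bar>w y - w x\<bar> powr p)
      \<le> ennreal ((2*r) powr p) * (\<integral>\<^sup>+t. F (t *\<^sub>R y + (1 - t) *\<^sub>R x) * indicator {0..1/2} t + F (t *\<^sub>R y + (1 - t) *\<^sub>R x) * indicator {1/2..1} t \<partial>lborel)"
      by (rule order_trans[OF upper_gradient_powr[OF ug p] mult_mono[OF ennreal_leI[OF 1] 2]]) auto
    also have "(\<integral>\<^sup>+t. F (t *\<^sub>R y + (1 - t) *\<^sub>R x) * indicator {0..1/2} t + F (t *\<^sub>R y + (1 - t) *\<^sub>R x) * indicator {1/2..1} t \<partial>lborel)
      = (\<integral>\<^sup>+t\<in>{0..1/2}. F (t *\<^sub>R y + (1 - t) *\<^sub>R x) \<partial>lborel) + (\<integral>\<^sup>+t\<in>{0..1/2}. F (t *\<^sub>R x + (1 - t) *\<^sub>R y) \<partial>lborel)"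
      by (subst nn_integral_add) (auto simp: 3)
    finally show ?thesis by (simp add: P_def)
  qed
  then have "(\<integral>\<^sup>+x\<in>K. (\<integral>\<^sup>+y\<in>K. ennreal (\<bar>w y - w x\<bar> powr p) \<partial>lborel) \<partial>lborel)
    \<le> (\<integral>\<^sup>+x. (\<integral>\<^sup>+y. ennreal ((2*r) powr p) * (P x y * indicator K x * indicator K y
        + P y x * indicator K y * indicator K x) \<partial>lborel) \<partial>lborel)"
    apply (intro nn_integral_mono)
    subgoal for x
      by (cases "x \<in> K") (auto intro!: nn_integral_mono simp: indicator_def)
    done
  also have "\<dots> = (\<integral>\<^sup>+x. ennreal ((2*r) powr p) * ((\<integral>\<^sup>+y. P x y * indicator K x * indicator K y \<partial>lborel)
        + (\<integral>\<^sup>+y. P y x * indicator K y * indicator K x \<partial>lborel)) \<partial>lborel)"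
    by (intro nn_integral_cong) (subst nn_integral_cmult, measurable, subst nn_integral_add, measurable)
  also have "\<dots> = ennreal ((2*r) powr p) * (S + S)"
    unfolding S' by (subst nn_integral_cmult, measurable, subst nn_integral_add, measurable) (simp add: S'[symmetric] S_def)
  also have "\<dots> \<le> ennreal ((2*r) powr p) *
     (ennreal (2 ^ DIM('a)) * ennreal (1/2) * emeasure lborel K * ?I + ennreal (2 ^ DIM('a)) * ennreal (1/2) * emeasure lborel K * ?I)"
    by (intro mult_left_mono add_mono S_le) auto
  also have "\<dots>
     = ennreal ((2 * r) powr p * 2 ^ DIM('a)) * emeasure lborel K * ?I"
  proof -
    have "ennreal (2 ^ DIM('a)) * ennreal (1/2) * X + ennreal (2 ^ DIM('a)) * ennreal (1/2) * X = ennreal (2 ^ DIM('a)) * X" for X :: ennreal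
    proof -
      have "ennreal (2 ^ DIM('a)) * ennreal (1/2) * X + ennreal (2 ^ DIM('a)) * ennreal (1/2) * X
        = ennreal (2 ^ DIM('a)) * (ennreal (1/2) + ennreal (1/2)) * X"
        by (simp add: distrib_left distrib_right)
      also have "ennreal (1/2) + ennreal (1/2) = 1"
        by (subst ennreal_plus[symmetric]) auto
      finally show ?thesis by simp
    qed
    from this[of "emeasure lborel K * ?I"] show ?thesis
      by (simp add: ennreal_mult' mult.assoc)
  qed
  finally show ?thesis by (simp add: K_def)
qed

section \<open>Averages over balls\<close>

text \<open>
The \<open>p\<close>-th power of the \<open>L^p\<close> norm, for functions as well as for upper gradients; its extended
values make monotonicity, Fubini and countable additivity available without side conditions.
\<close>

definition energy :: "real \<Rightarrow> ('a::euclidean_space \<Rightarrow> real) \<Rightarrow> 'a set \<Rightarrow> ennreal" where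
  "energy p f S = (\<integral>\<^sup>+x\<in>S. ennreal (\<bar>f x\<bar> powr p) \<partial>lborel)"

definition ball_average :: "('a::euclidean_space \<Rightarrow> real) \<Rightarrow> 'a \<Rightarrow> real \<Rightarrow> real" where
  "ball_average w y r = (LINT x:ball y r|lborel. w x) / measure lborel (ball y r)"

lemma energy_mono: "S \<subseteq> S' \<Longrightarrow> energy p f S \<le> energy p f S'"
  unfolding energy_def by (intro nn_integral_mono) (auto simp: indicator_def)

lemma energy_finite:
  fixes f :: "'a::euclidean_space \<Rightarrow> real"
  assumes f: "continuous_on UNIV f" and S: "bounded S" and p: "0 < p"
  shows "energy p f S < \<infinity>"
proof -
  obtain z r where S': "S \<subseteq> cball z r" using S bounded_subset_cball by blast
  have "compact ((\<lambda>x. \<bar>f x\<bar> powr p) ` cball z r)"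
    using f p by (intro compact_continuous_image continuous_on_powr' continuous_intros) (auto intro: continuous_on_subset)
  then obtain b where b: "\<bar>f x\<bar> powr p \<le> b" if "x \<in> cball z r" for x
    using bounded_has_Sup(1)[of "(\<lambda>x. \<bar>f x\<bar> powr p) ` cball z r"] compact_imp_bounded 
    by (metis empty_iff image_eqI)
  have "energy p f S \<le> (\<integral>\<^sup>+x\<in>cball z r. ennreal b \<partial>lborel)"
    unfolding energy_def using S' b by (intro nn_integral_mono) (auto simp: indicator_def ennreal_leI)
  also have "\<dots> < \<infinity>"
    using emeasure_lborel_cball_finite[of z r]
    by (subst nn_integral_cmult_indicator) (auto simp: ennreal_mult_less_top)
  finally show ?thesis .
qed

lemma unit_ball_vol_nonzero: "unit_ball_vol (real n) \<noteq> 0"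
  using unit_ball_vol_pos[OF of_nat_0_le_iff, of n] by (rule less_imp_neq[symmetric])

lemma measure_ball_pos: "0 < r \<Longrightarrow> 0 < measure lborel (ball (z::'a::euclidean_space) r)"
  by (simp add: content_ball)

lemma ennreal_measure_ball: "ennreal (measure lborel (ball (z::'a::euclidean_space) r)) = emeasure lborel (ball z r)"
  using emeasure_lborel_ball_finite[of z r] by (intro emeasure_eq_ennreal_measure[symmetric]) auto

lemma set_integrable_ball:
  fixes w :: "'a::euclidean_space \<Rightarrow> real"
  assumes "continuous_on UNIV w"
  shows "set_integrable lborel (ball z r) w"
proof (rule set_integrable_subset)
  show "set_integrable lborel (cball z r) w"
    unfolding set_integrable_def using assms
    by (intro borel_integrable_compact) (auto intro: continuous_on_subset)
qed auto

lemma ball_average_diff_powr_le: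
  fixes w :: "'a::euclidean_space \<Rightarrow> real"
  assumes w: "continuous_on UNIV w" and p: "1 \<le> p" and r: "0 < r"
  shows "ennreal (\<bar>ball_average w y r - c\<bar> powr p)
    \<le> ennreal (1 / measure lborel (ball y r)) * energy p (\<lambda>x. w x - c) (ball y r)"
proof -
  define m where "m = measure lborel (ball y r)"
  have m: "m > 0" using measure_ball_pos[OF r] by (simp add: m_def)
  have si: "set_integrable lborel (ball y r) (\<lambda>x. w x - c)"
    using w by (intro set_integrable_ball continuous_intros)
  have "(LINT x:ball y r|lborel. w x - c) = (LINT x:ball y r|lborel. w x) - m * c"
    using set_integrable_ball[OF w] emeasure_lborel_ball_finite[of y r]
    by (subst set_integral_diff) (auto simp: m_def set_integrable_ball set_lebesgue_integral_def[of _ _ "\<lambda>_. c"])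
  then have "ball_average w y r - c = (LINT x:ball y r|lborel. w x - c) / m"
    using m by (simp add: ball_average_def m_def field_simps)
  then have "\<bar>ball_average w y r - c\<bar> powr p = (1 / m) powr p * \<bar>LINT x:ball y r|lborel. w x - c\<bar> powr p"
    using m by (simp add: abs_divide powr_divide)
  then have "ennreal (\<bar>ball_average w y r - c\<bar> powr p)
      = ennreal ((1 / m) powr p) * ennreal (\<bar>LINT x:ball y r|lborel. w x - c\<bar> powr p)"
    by (simp add: ennreal_mult')
  also have "\<dots> \<le> ennreal ((1 / m) powr p) * (ennreal (m powr (p - 1)) * energy p (\<lambda>x. w x - c) (ball y r))"
    unfolding energy_def m_def using emeasure_lborel_ball_finite[of y r]
    by (intro mult_left_mono set_integral_powr_le p si) auto
  also have "\<dots> = ennreal ((1 / m) powr p * m powr (p - 1)) * energy p (\<lambda>x. w x - c) (ball y r)"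
    by (simp add: ennreal_mult' mult.assoc)
  also have "(1 / m) powr p * m powr (p - 1) = 1 / m"
    using m by (simp add: powr_divide powr_diff)
  finally show ?thesis by (simp add: m_def)
qed

lemma ball_average_tendsto:
  fixes w :: "'a::euclidean_space \<Rightarrow> real"
  assumes w: "continuous_on UNIV w" and r: "0 < r"
  shows "(\<lambda>n. ball_average w y (r / 2 ^ n)) \<longlonglongrightarrow> w y"
proof (rule LIMSEQ_I)
  fix e :: real assume e: "0 < e"
  have "\<exists>d>0. \<forall>x\<in>UNIV. dist x y < d \<longrightarrow> dist (w x) (w y) < e/2"
    using w[unfolded continuous_on_iff, THEN bspec[of _ _ y], THEN spec[of _ "e/2"]] e by simp
  then obtain d where d: "d > 0" "\<And>x. dist x y < d \<Longrightarrow> \<bar>w x - w y\<bar> < e/2"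
    by (auto simp: dist_real_def)
  have "(\<lambda>n. r / 2 ^ n) \<longlonglongrightarrow> 0"
    by (rule LIMSEQ_divide_realpow_zero) simp
  then have "eventually (\<lambda>n. r / 2 ^ n < d) sequentially"
    using d(1) by (rule order_tendstoD(2))
  then obtain N where N: "\<And>n. n \<ge> N \<Longrightarrow> r / 2 ^ n < d"
    unfolding eventually_sequentially by blast
  show "\<exists>no. \<forall>n\<ge>no. norm (ball_average w y (r / 2 ^ n) - w y) < e"
  proof (intro exI allI impI)
    fix n assume "n \<ge> N"
    define s where "s = r / 2 ^ n"
    have s: "0 < s" "s < d" using N[OF \<open>n \<ge> N\<close>] r by (auto simp: s_def)
    have "energy 1 (\<lambda>x. w x - w y) (ball y s) \<le> (\<integral>\<^sup>+x\<in>ball y s. ennreal (e/2) \<partial>lborel)"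
      unfolding energy_def
    proof (rule nn_integral_mono)
      fix x show "ennreal (\<bar>w x - w y\<bar> powr 1) * indicator (ball y s) x \<le> ennreal (e/2) * indicator (ball y s) x"
        using d(2)[of x] s by (auto simp: indicator_def dist_commute intro!: ennreal_leI)
    qed
    also have "\<dots> = ennreal (e/2 * measure lborel (ball y s))"
      using e by (subst nn_integral_cmult_indicator) (auto simp: ennreal_measure_ball[symmetric] ennreal_mult'[symmetric])
    finally have en: "energy 1 (\<lambda>x. w x - w y) (ball y s) \<le> ennreal (e/2 * measure lborel (ball y s))" .
    have "ennreal (\<bar>ball_average w y s - w y\<bar> powr 1)
        \<le> ennreal (1 / measure lborel (ball y s)) * ennreal (e/2 * measure lborel (ball y s))"
      by (rule order_trans[OF ball_average_diff_powr_le[OF w _ s(1)] mult_left_mono[OF en]]) auto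
    also have "\<dots> = ennreal (e/2)"
      using measure_ball_pos[OF s(1), of y] by (simp add: ennreal_mult'[symmetric])
    finally show "norm (ball_average w y (r / 2 ^ n) - w y) < e"
      using e by (simp add: s_def ennreal_le_iff2)
  qed
qed

lemma ennreal_mult3:
  "0 \<le> a \<Longrightarrow> 0 \<le> b \<Longrightarrow> 0 \<le> c \<Longrightarrow>
    ennreal a * (ennreal b * ennreal c * e) = ennreal (a * b * c) * e"
  by (simp add: ennreal_mult mult.assoc)

text \<open>
By Jensen's inequality, subtracting the average over a subball costs no more than averaging all
differences, and those are controlled by the double integral.
\<close>

lemma poincare_ball_average:
  fixes w g :: "'a::euclidean_space \<Rightarrow> real"
  assumes ug: "upper_gradient w g" and p: "1 \<le> p" and s: "0 < s" and sub: "ball y s \<subseteq> ball z r"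
  shows "energy p (\<lambda>x. w x - ball_average w y s) (ball z r)
    \<le> ennreal ((2 * r) powr p * (2 * r / s) ^ DIM('a)) * energy p g (ball z r)"
proof -
  let ?K = "ball z r" and ?B = "ball y s"
  have w: "continuous_on UNIV w" using ug by (simp add: upper_gradient_def)
  have [measurable]: "w \<in> borel_measurable borel" using w by (rule borel_measurable_continuous_onI)
  have r: "0 < r" using s sub by (metis ball_eq_empty bot.extremum_uniqueI linorder_not_le)
  have [measurable]: "?K \<in> sets borel" "?B \<in> sets borel" by auto
  have "ennreal (\<bar>w x - ball_average w y s\<bar> powr p)
     \<le> ennreal (1 / measure lborel ?B) * (\<integral>\<^sup>+u\<in>?K. ennreal (\<bar>w u - w x\<bar> powr p) \<partial>lborel)" for x
    using order_trans[OF ball_average_diff_powr_le[OF w p s, of y "w x"]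
        mult_left_mono[OF energy_mono[OF sub, of p "\<lambda>u. w u - w x"]]]
    by (simp add: energy_def abs_minus_commute)
  then have "energy p (\<lambda>x. w x - ball_average w y s) ?K
    \<le> (\<integral>\<^sup>+x\<in>?K. (ennreal (1 / measure lborel ?B) * (\<integral>\<^sup>+u\<in>?K. ennreal (\<bar>w u - w x\<bar> powr p) \<partial>lborel)) \<partial>lborel)"
    unfolding energy_def by (intro nn_integral_mono mult_right_mono) auto
  also have "\<dots> = ennreal (1 / measure lborel ?B) * 
      (\<integral>\<^sup>+x\<in>?K. (\<integral>\<^sup>+u\<in>?K. ennreal (\<bar>w u - w x\<bar> powr p) \<partial>lborel) \<partial>lborel)"
    unfolding mult.assoc by (rule nn_integral_cmult) measurable
  also have "\<dots> \<le> ennreal (1 / measure lborel ?B) * (ennreal ((2 * r) powr p * 2 ^ DIM('a)) * emeasure lborel ?K *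
       (\<integral>\<^sup>+x\<in>?K. ennreal (g x powr p) \<partial>lborel))"
    using r by (intro mult_left_mono double_poincare ug p) auto
  also have "(\<integral>\<^sup>+x\<in>?K. ennreal (g x powr p) \<partial>lborel) = energy p g ?K"
    using ug by (simp add: energy_def upper_gradient_def)
  also have "ennreal (1 / measure lborel ?B) * (ennreal ((2 * r) powr p * 2 ^ DIM('a)) * emeasure lborel ?K * energy p g ?K)
      = ennreal (1 / measure lborel ?B * ((2 * r) powr p * 2 ^ DIM('a)) * measure lborel ?K) * energy p g ?K"
    unfolding ennreal_measure_ball[symmetric] by (rule ennreal_mult3) auto
  also have "1 / measure lborel ?B * ((2 * r) powr p * 2 ^ DIM('a)) * measure lborel ?K
      = (2 * r) powr p * (2 * r / s) ^ DIM('a)"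
    using r s unit_ball_vol_nonzero[of "DIM('a)"] by (simp add: content_ball power_divide power_mult_distrib)
  finally show ?thesis .
qed

text \<open>
The power \<open>r powr (p - d)\<close> is the scaling of the Poincare inequality: it makes a jump between
consecutive averages expensive for small \<open>r\<close> exactly in comparison with \<open>r powr l\<close>, \<open>l > d - p\<close>.
\<close>

lemma ball_average_halving:
  fixes w g :: "'a::euclidean_space \<Rightarrow> real"
  assumes ug: "upper_gradient w g" and p: "1 \<le> p" and r: "0 < r"
  shows "ennreal (\<bar>ball_average w y (r / 2) - ball_average w y r\<bar> powr p)
    \<le> ennreal (2 powr p * 4 ^ DIM('a) / unit_ball_vol DIM('a) * r powr (p - DIM('a))) * energy p g (ball y r)"
proof -
  have w: "continuous_on UNIV w" using ug by (simp add: upper_gradient_def)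
  have "ennreal (\<bar>ball_average w y (r / 2) - ball_average w y r\<bar> powr p)
    \<le> ennreal (1 / measure lborel (ball y (r / 2))) * energy p (\<lambda>x. w x - ball_average w y r) (ball y (r / 2))"
    using r by (intro ball_average_diff_powr_le w p) auto
  also have "\<dots> \<le> ennreal (1 / measure lborel (ball y (r / 2))) *
      (ennreal ((2 * r) powr p * (2 * r / r) ^ DIM('a)) * energy p g (ball y r))"
    using r by (intro mult_left_mono order_trans[OF energy_mono poincare_ball_average] ug p) auto
  also have "\<dots> = ennreal (1 / measure lborel (ball y (r / 2)) * ((2 * r) powr p * (2 * r / r) ^ DIM('a))) * energy p g (ball y r)"
    by (subst (2) ennreal_mult) (auto simp: mult.assoc)
  also have "1 / measure lborel (ball y (r / 2)) * ((2 * r) powr p * (2 * r / r) ^ DIM('a))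
     = 2 powr p * 4 ^ DIM('a) / unit_ball_vol DIM('a) * r powr (p - DIM('a))"
    using r unit_ball_vol_nonzero[of "DIM('a)"]
    by (simp add: content_ball power_divide powr_mult powr_diff powr_realpow power_mult_distrib[symmetric])
  finally show ?thesis .
qed

text \<open>
If all jumps were smaller than the terms of a geometric series of total \<open>m / 2\<close>, the sequence could
not get from size \<open>m\<close> to \<open>0\<close>.
\<close>

lemma geometric_jump:
  fixes a :: "nat \<Rightarrow> real" and \<theta> :: real
  assumes a: "a \<longlonglongrightarrow> 0" and m: "0 < m" "m \<le> \<bar>a 0\<bar>" and \<theta>: "0 < \<theta>" "\<theta> < 1"
  obtains j where "m / 2 * (1 - \<theta>) * \<theta> ^ j \<le> \<bar>a (Suc j) - a j\<bar>"
proof (rule ccontr)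
  assume "\<not> thesis"
  then have less: "\<bar>a (Suc j) - a j\<bar> \<le> m / 2 * (1 - \<theta>) * \<theta> ^ j" for j
    using that by (meson linorder_le_cases)
  have "\<bar>a n - a 0\<bar> \<le> m / 2" for n
  proof -
    have "\<bar>a n - a 0\<bar> = \<bar>\<Sum>j<n. a (Suc j) - a j\<bar>" by (simp add: sum_lessThan_telescope)
    also have "\<dots> \<le> (\<Sum>j<n. m / 2 * (1 - \<theta>) * \<theta> ^ j)"
      by (rule order_trans[OF sum_abs sum_mono]) (rule less)
    also have "\<dots> = m / 2 * ((1 - \<theta>) * (\<Sum>j<n. \<theta> ^ j))"
      by (simp add: sum_distrib_left mult.assoc)
    also have "(1 - \<theta>) * (\<Sum>j<n. \<theta> ^ j) = 1 - \<theta> ^ n" by (simp add: one_diff_power_eq)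
    also have "m / 2 * (1 - \<theta> ^ n) \<le> m / 2" using m \<theta> by simp
    finally show ?thesis .
  qed
  moreover have "(\<lambda>n. \<bar>a n - a 0\<bar>) \<longlonglongrightarrow> \<bar>0 - a 0\<bar>" by (intro tendsto_intros a)
  ultimately have "\<bar>0 - a 0\<bar> \<le> m / 2" by (intro LIMSEQ_le_const2) auto
  then show False using m by simp
qed

section \<open>Concentration of the gradient and Hausdorff content\<close>

text \<open>
The content is defined by sequences of balls with positive radii. A countable and possibly finite
cover is padded by balls about a fixed point of \<open>F\<close> whose radii contribute at most \<open>e\<close> in total.
\<close>

lemma hausdorff_content_le_cover:
  fixes F :: "(real^'n) set"
  assumes I: "countable I" and a: "\<And>i. i \<in> I \<Longrightarrow> a i \<in> F" and r: "\<And>i. i \<in> I \<Longrightarrow> 0 < r i"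
    and cover: "F \<subseteq> (\<Union>i\<in>I. ball (a i) (r i))" and F: "F \<noteq> {}" and l: "0 < l"
  shows "hausdorff_content l F \<le> (\<integral>\<^sup>+i. ennreal (r i powr l) \<partial>count_space I)"
proof (rule ennreal_le_epsilon)
  fix e :: real assume e: "0 < e"
  obtain x0 where x0: "x0 \<in> F" using F by auto
  \<comment> \<open>The \<open>l\<close>-th powers of the padding radii sum up to \<open>e\<close>.\<close>
  define \<epsilon> where "\<epsilon> = (\<lambda>j::nat. (e * (1/2) ^ Suc j) powr (1 / l))"
  have \<epsilon>: "\<epsilon> j > 0" "\<epsilon> j powr l = e * (1/2) ^ Suc j" for j
    using e l by (simp_all add: \<epsilon>_def powr_powr)
  define J where "J = to_nat_on I ` I"
  define c where "c = (\<lambda>j. if j \<in> J then a (from_nat_into I j) else x0)"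
  define s where "s = (\<lambda>j. if j \<in> J then r (from_nat_into I j) else \<epsilon> j)"
  have from_nat: "from_nat_into I j \<in> I" if "j \<in> J" for j
    using that I by (auto simp: J_def)
  have bij: "bij_betw (from_nat_into I) J I"
    unfolding J_def using I
    by (auto simp: bij_betw_def inj_on_def image_image to_nat_on_finite)
  have "hausdorff_content l F \<le> (\<Sum>j. ennreal (s j powr l))"
    unfolding hausdorff_content_def
  proof (rule Inf_lower, clarify, intro exI conjI)
    show "(\<Sum>j. ennreal (s j powr l)) = (\<Sum>j. ennreal (s j powr l))" ..
    show "\<forall>j. c j \<in> F \<and> s j > 0"
      using from_nat a r x0 \<epsilon> by (auto simp: c_def s_def)
    show "F \<subseteq> (\<Union>j. ball (c j) (s j))"
    proof
      fix y assume "y \<in> F"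
      then obtain i where i: "i \<in> I" "y \<in> ball (a i) (r i)" using cover by auto
      have "to_nat_on I i \<in> J" using i by (auto simp: J_def)
      then show "y \<in> (\<Union>j. ball (c j) (s j))"
        using i I by (auto intro!: exI[of _ "to_nat_on I i"] simp: c_def s_def)
    qed
  qed
  also have "(\<Sum>j. ennreal (s j powr l))
      \<le> (\<Sum>j. ennreal (r (from_nat_into I j) powr l) * indicator J j + ennreal (e * (1/2) ^ Suc j))"
    by (intro suminf_le allI) (auto simp: s_def indicator_def \<epsilon>)
  also have "\<dots> = (\<Sum>j. ennreal (r (from_nat_into I j) powr l) * indicator J j) + (\<Sum>j. ennreal (e * (1/2) ^ Suc j))"
    by (intro suminf_add[symmetric]) auto
  also have "(\<Sum>j. ennreal (e * (1/2) ^ Suc j)) = ennreal e"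
  proof -
    have "(\<lambda>j. e * (1/2) ^ Suc j) sums (e * 1)"
      using power_half_series by (rule sums_mult)
    then show ?thesis using e by (intro suminf_ennreal_eq) auto
  qed
  also have "(\<Sum>j. ennreal (r (from_nat_into I j) powr l) * indicator J j)
      = (\<integral>\<^sup>+j. ennreal (r (from_nat_into I j) powr l) * indicator J j \<partial>count_space UNIV)"
    by (rule nn_integral_count_space_nat[symmetric])
  also have "\<dots> = (\<integral>\<^sup>+j. ennreal (r (from_nat_into I j) powr l) \<partial>count_space J)"
    by (subst nn_integral_count_space_indicator) auto
  also have "\<dots> = (\<integral>\<^sup>+i. ennreal (r i powr l) \<partial>count_space I)"
    using bij by (rule nn_integral_bij_count_space)
  finally show "hausdorff_content l F \<le> (\<integral>\<^sup>+i. ennreal (r i powr l) \<partial>count_space I) + ennreal e" .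
qed

lemma energy_disjoint_balls:
  fixes g :: "'a::euclidean_space \<Rightarrow> real"
  assumes I: "countable I" and g: "g \<in> borel_measurable borel" and K: "K \<in> sets borel"
    and disj: "disjoint_family_on B I" and B: "\<And>i. i \<in> I \<Longrightarrow> B i \<in> sets borel \<and> B i \<subseteq> K"
  shows "(\<integral>\<^sup>+i. energy p g (B i) \<partial>count_space I) \<le> energy p g K"
proof -
  define N where "N = density lborel (\<lambda>x. ennreal (\<bar>g x\<bar> powr p))"
  have [measurable]: "g \<in> borel_measurable borel" by (rule g)
  have eN: "energy p g S = emeasure N S" if "S \<in> sets borel" for S
    unfolding N_def energy_def using that by (subst emeasure_density) auto
  have "(\<integral>\<^sup>+i. energy p g (B i) \<partial>count_space I) = (\<integral>\<^sup>+i. emeasure N (B i) \<partial>count_space I)"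
    using B by (intro nn_integral_cong) (auto simp: eN)
  also have "\<dots> = emeasure N (\<Union>i\<in>I. B i)"
    using B by (intro emeasure_UN_countable[symmetric] I disj) (auto simp: N_def)
  also have "\<dots> \<le> emeasure N K"
    using B K by (intro emeasure_mono) (auto simp: N_def)
  finally show ?thesis using eN[OF K] by simp
qed

text \<open>
Comparison of the jumps of the averages with a geometric sequence of ratio \<open>\<theta> = 2 powr (- \<sigma> / p)\<close>,
where \<open>\<sigma> = l - d + p > 0\<close>. This ratio is chosen such that a large jump at radius \<open>r\<close> has \<open>p\<close>-th
power about \<open>m^p (r / \<rho>)^\<sigma>\<close>; divided by the factor \<open>r^(p - d)\<close> of the halving lemma, this is
\<open>m^p r^l / \<rho>^\<sigma>\<close>, a quantity that can be summed in the definition of the content.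
\<close>

lemma concentration_at_zero:
  fixes w g :: "'a::euclidean_space \<Rightarrow> real"
  assumes ug: "upper_gradient w g" and p: "1 \<le> p" and \<rho>: "0 < \<rho>" and y: "w y = 0"
    and l: "real DIM('a) - p < l" and m: "0 < m" "m \<le> \<bar>ball_average w y \<rho>\<bar>"
    and c_def: "c = 2 powr p * 4 ^ DIM('a) / unit_ball_vol DIM('a) *
      (2 / (1 - 2 powr (- (l - DIM('a) + p) / p))) powr p"
  obtains r where "0 < r" "r \<le> \<rho>"
    "ennreal (m powr p * r powr l) \<le> ennreal (c * \<rho> powr (l - DIM('a) + p)) * energy p g (ball y r)"
proof -
  define d where "d = real DIM('a)"
  define \<sigma> where "\<sigma> = l - d + p"
  have \<sigma>: "0 < \<sigma>" using l by (simp add: \<sigma>_def d_def)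
  define \<theta> where "\<theta> = 2 powr (- \<sigma> / p)"
  have \<theta>: "0 < \<theta>" "\<theta> < 1"
    using \<sigma> p by (auto simp: \<theta>_def powr_less_one)
  define V where "V = 2 powr p * 4 ^ DIM('a) / unit_ball_vol DIM('a)"
  have V: "0 < V" by (simp add: V_def)
  have c: "c = V * (2 / (1 - \<theta>)) powr p" by (simp add: c_def V_def \<theta>_def \<sigma>_def d_def)
  have "(\<lambda>n. ball_average w y (\<rho> / 2 ^ n)) \<longlonglongrightarrow> 0"
    using ball_average_tendsto[of w \<rho> y] ug \<rho> y by (simp add: upper_gradient_def)
  then obtain j where j: "m / 2 * (1 - \<theta>) * \<theta> ^ j
      \<le> \<bar>ball_average w y (\<rho> / 2 ^ Suc j) - ball_average w y (\<rho> / 2 ^ j)\<bar>"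
    by (rule geometric_jump[where m = m and \<theta> = \<theta>]) (use m \<theta> in auto)
  define r where "r = \<rho> / 2 ^ j"
  have r: "0 < r" "r \<le> \<rho>" using \<rho> by (auto simp: r_def divide_le_eq)
  have "(\<theta> ^ j) powr p = (r / \<rho>) powr \<sigma>"
  proof -
    have "(\<theta> ^ j) powr p = \<theta> powr (real j * p)"
      using \<theta> by (simp add: powr_realpow[symmetric] powr_powr)
    also have "\<dots> = 2 powr (- \<sigma> * real j)" using p by (simp add: \<theta>_def powr_powr)
    also have "\<dots> = (2 powr (- real j)) powr \<sigma>" by (simp add: powr_powr mult.commute)
    also have "2 powr (- real j) = r / \<rho>"
      using \<rho> by (simp add: r_def powr_minus powr_realpow divide_simps)
    finally show ?thesis .
  qed
  moreover have "m / 2 * (1 - \<theta>) * \<theta> ^ j = m * ((1 - \<theta>) / 2) * \<theta> ^ j" by simp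
  ultimately have eq: "(m / 2 * (1 - \<theta>) * \<theta> ^ j) powr p = m powr p * ((1 - \<theta>) / 2) powr p * (r / \<rho>) powr \<sigma>"
    by (simp only: powr_mult)
  have "ennreal ((m / 2 * (1 - \<theta>) * \<theta> ^ j) powr p)
      \<le> ennreal (\<bar>ball_average w y (r / 2) - ball_average w y r\<bar> powr p)"
    using j m \<theta> p by (intro ennreal_leI powr_mono2) (auto simp: r_def mult.commute)
  also have "\<dots> \<le> ennreal (V * r powr (p - d)) * energy p g (ball y r)"
    using ball_average_halving[OF ug p r(1), of y] by (simp add: V_def d_def)
  finally have 1: "ennreal (m powr p * ((1 - \<theta>) / 2) powr p * (r / \<rho>) powr \<sigma>)
      \<le> ennreal (V * r powr (p - d)) * energy p g (ball y r)" unfolding eq .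
  \<comment> \<open>The factor by which the inequality is multiplied to isolate \<open>m powr p * r powr l\<close>.\<close>
  define k where "k = (2 / (1 - \<theta>)) powr p * r powr (d - p) * \<rho> powr \<sigma>"
  have "(m powr p * r powr l) = k * (m powr p * ((1 - \<theta>) / 2) powr p * (r / \<rho>) powr \<sigma>)"
  proof -
    have "(2 / (1 - \<theta>)) powr p * ((1 - \<theta>) / 2) powr p = 1"
    proof -
      have "2 / (1 - \<theta>) * ((1 - \<theta>) / 2) = 1" using \<theta> by simp
      then show ?thesis by (simp only: powr_mult[symmetric] powr_one_eq_one)
    qed
    moreover have "r powr (d - p) * \<rho> powr \<sigma> * (r / \<rho>) powr \<sigma> = r powr l"
      using r \<rho> by (simp add: powr_divide powr_add[symmetric] \<sigma>_def)
    moreover have "k * (m powr p * ((1 - \<theta>) / 2) powr p * (r / \<rho>) powr \<sigma>)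
        = ((2 / (1 - \<theta>)) powr p * ((1 - \<theta>) / 2) powr p)
          * (r powr (d - p) * \<rho> powr \<sigma> * (r / \<rho>) powr \<sigma>) * m powr p"
      by (simp only: k_def mult_ac)
    ultimately show ?thesis by auto
  qed
  then have "ennreal (m powr p * r powr l) = ennreal k * ennreal (m powr p * ((1 - \<theta>) / 2) powr p * (r / \<rho>) powr \<sigma>)"
    by (simp add: ennreal_mult'[symmetric] k_def)
  also have "\<dots> \<le> ennreal k * (ennreal (V * r powr (p - d)) * energy p g (ball y r))"
    by (intro mult_left_mono 1) auto
  also have "\<dots> = ennreal (k * (V * r powr (p - d))) * energy p g (ball y r)"
    using V by (simp add: k_def ennreal_mult mult.assoc)
  also have "k * (V * r powr (p - d)) = c * \<rho> powr \<sigma>"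
  proof -
    have "r powr (d - p) * r powr (p - d) = 1" using r by (simp add: powr_add[symmetric])
    moreover have "k * (V * r powr (p - d)) = (r powr (d - p) * r powr (p - d)) * (V * (2 / (1 - \<theta>)) powr p) * \<rho> powr \<sigma>"
      by (simp only: k_def mult_ac)
    ultimately show ?thesis by (simp add: c)
  qed
  finally show ?thesis using that[of r] r by (simp add: \<sigma>_def d_def)
qed

text \<open>
Every point of \<open>F\<close> is the centre of a ball on which the gradient concentrates. Vitali's lemma selects
disjoint ones whose fivefold enlargements cover \<open>F\<close>; disjointness adds up the energies, and the
enlargement costs the factor \<open>5 powr l\<close>.
\<close>

lemma content_average_bound:
  fixes w g :: "real^'n \<Rightarrow> real"
  assumes ug: "upper_gradient w g" and p: "1 \<le> p" and \<rho>: "0 < \<rho>"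
    and F: "F \<noteq> {}" "F \<subseteq> ball z \<rho>" and w0: "\<And>y. y \<in> F \<Longrightarrow> w y = 0"
    and l: "0 < l" "real CARD('n) - p < l" and m: "0 < m" "\<And>y. y \<in> F \<Longrightarrow> m \<le> \<bar>ball_average w y \<rho>\<bar>"
    and c_def: "c = 2 powr p * 4 ^ CARD('n) / unit_ball_vol CARD('n) *
      (2 / (1 - 2 powr (- (l - CARD('n) + p) / p))) powr p"
  shows "ennreal (m powr p) * hausdorff_content l F
    \<le> ennreal (5 powr l * c * \<rho> powr (l - CARD('n) + p)) * energy p g (ball z (2 * \<rho>))"
proof -
  define R where "R = c * \<rho> powr (l - CARD('n) + p)"
  have c0: "0 \<le> c" by (simp add: c_def)
  have "\<exists>r. \<forall>y\<in>F. 0 < r y \<and> r y \<le> \<rho> \<and> ennreal (m powr p * r y powr l) \<le> ennreal R * energy p g (ball y (r y))"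
  proof (rule bchoice, rule ballI)
    fix y assume y: "y \<in> F"
    show "\<exists>r. 0 < r \<and> r \<le> \<rho> \<and> ennreal (m powr p * r powr l) \<le> ennreal R * energy p g (ball y r)"
      by (rule concentration_at_zero[OF ug p \<rho> w0[OF y] _ m(1) m(2)[OF y], of l c])
        (use l in \<open>auto simp: c_def R_def\<close>)
  qed
  then obtain r where r: "\<And>y. y \<in> F \<Longrightarrow> 0 < r y \<and> r y \<le> \<rho>"
    and en: "\<And>y. y \<in> F \<Longrightarrow> ennreal (m powr p * r y powr l) \<le> ennreal R * energy p g (ball y (r y))"
    by blast
  obtain C where C: "countable C" "C \<subseteq> F"
     "pairwise (\<lambda>i j. disjnt (cball i (r i)) (cball j (r j))) C"
     and cov: "\<And>i. i \<in> F \<Longrightarrow> \<exists>j. j \<in> C \<and>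
                        \<not> disjnt (cball i (r i)) (cball j (r j)) \<and>
                        cball i (r i) \<subseteq> ball j (5 * r j)"
  proof (rule Vitali_covering_lemma_cballs_balls[of F r \<rho> "\<lambda>x. x"])
    show "0 < r i \<and> r i \<le> \<rho>" if "i \<in> F" for i using that by (rule r)
  qed (rule that; assumption)
  have cover: "F \<subseteq> (\<Union>i\<in>C. ball i (5 * r i))"
  proof
    fix y assume y: "y \<in> F"
    then have "y \<in> cball y (r y)" using r[OF y] by simp
    with cov[OF y] show "y \<in> (\<Union>i\<in>C. ball i (5 * r i))" by blast
  qed
  have "ennreal (m powr p) * hausdorff_content l F
      \<le> ennreal (m powr p) * (\<integral>\<^sup>+i. ennreal ((5 * r i) powr l) \<partial>count_space C)"
  proof (rule mult_left_mono)
    show "hausdorff_content l F \<le> (\<integral>\<^sup>+i. ennreal ((5 * r i) powr l) \<partial>count_space C)"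
      by (rule hausdorff_content_le_cover[OF C(1) _ _ cover F(1) l(1)]) (use C(2) r in auto)
  qed simp
  also have "\<dots> = (\<integral>\<^sup>+i. ennreal (5 powr l) * ennreal (m powr p * r i powr l) \<partial>count_space C)"
    by (subst nn_integral_cmult[symmetric])
       (auto intro!: nn_integral_cong simp: powr_mult ennreal_mult'[symmetric] mult_ac)
  also have "\<dots> \<le> (\<integral>\<^sup>+i. ennreal (5 powr l) * (ennreal R * energy p g (ball i (r i))) \<partial>count_space C)"
    using C en by (intro nn_integral_mono mult_left_mono) auto
  also have "\<dots> = ennreal (5 powr l) * (ennreal R * (\<integral>\<^sup>+i. energy p g (ball i (r i)) \<partial>count_space C))"
    by (subst nn_integral_cmult, simp, subst nn_integral_cmult) auto
  also have "(\<integral>\<^sup>+i. energy p g (ball i (r i)) \<partial>count_space C) \<le> energy p g (ball z (2 * \<rho>))"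
  proof (rule energy_disjoint_balls)
    show "disjoint_family_on (\<lambda>i. ball i (r i)) C"
      unfolding disjoint_family_on_def
    proof (intro ballI impI)
      fix i j assume "i \<in> C" "j \<in> C" "i \<noteq> j"
      then have "disjnt (cball i (r i)) (cball j (r j))" using C(3) by (auto simp: pairwise_def)
      then show "ball i (r i) \<inter> ball j (r j) = {}"
        using ball_subset_cball unfolding disjnt_def by blast
    qed
    show "g \<in> borel_measurable borel"
      using ug by (auto simp: upper_gradient_def intro: borel_measurable_continuous_onI)
    fix i assume i: "i \<in> C"
    have "ball i (r i) \<subseteq> ball z (2 * \<rho>)"
    proof
      fix x assume "x \<in> ball i (r i)"
      then have "dist i x < \<rho>" "dist z i < \<rho>" using r[of i] i C(2) F(2) by auto
      then show "x \<in> ball z (2 * \<rho>)" using dist_triangle[of z x i] by simp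
    qed
    then show "ball i (r i) \<in> sets borel \<and> ball i (r i) \<subseteq> ball z (2 * \<rho>)" by simp
  qed (use C in auto)
  also have "ennreal (5 powr l) * (ennreal R * energy p g (ball z (2 * \<rho>)))
      = ennreal (5 powr l * c * \<rho> powr (l - CARD('n) + p)) * energy p g (ball z (2 * \<rho>))"
    using c0 by (simp add: R_def ennreal_mult mult.assoc)
  finally show ?thesis by (simp add: mult_left_mono)
qed

section \<open>The Poincare inequality at points of a thick set\<close>

lemma powr_add_le:
  fixes a b p :: real
  assumes "0 \<le> a" "0 \<le> b" "0 \<le> p"
  shows "(a + b) powr p \<le> 2 powr p * (a powr p + b powr p)"
proof -
  have "(a + b) powr p \<le> (2 * max a b) powr p" using assms by (intro powr_mono2) auto
  also have "\<dots> = 2 powr p * max a b powr p" using assms by (simp add: powr_mult)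
  also have "max a b powr p \<le> a powr p + b powr p" by (auto simp: max_def)
  finally show ?thesis by simp
qed

lemma energy_add_le:
  fixes f h :: "'a::euclidean_space \<Rightarrow> real"
  assumes [measurable]: "f \<in> borel_measurable borel" "h \<in> borel_measurable borel" "S \<in> sets borel" and p: "0 \<le> p"
  shows "energy p (\<lambda>x. f x + h x) S \<le> ennreal (2 powr p) * (energy p f S + energy p h S)"
proof -
  have "\<bar>f x + h x\<bar> powr p \<le> 2 powr p * (\<bar>f x\<bar> powr p + \<bar>h x\<bar> powr p)" for x
    using order_trans[OF powr_mono2[OF p _ abs_triangle_ineq] powr_add_le[of "\<bar>f x\<bar>" "\<bar>h x\<bar>" p]] p by simp
  then have "energy p (\<lambda>x. f x + h x) S
      \<le> (\<integral>\<^sup>+x. ennreal (2 powr p) * (ennreal (\<bar>f x\<bar> powr p) * indicator S x + ennreal (\<bar>h x\<bar> powr p) * indicator S x) \<partial>lborel)"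
    unfolding energy_def
    by (intro nn_integral_mono)
       (auto simp: indicator_def ennreal_mult'[symmetric] ennreal_plus[symmetric] simp del: ennreal_plus intro!: ennreal_leI)
  also have "\<dots> = ennreal (2 powr p) * (energy p f S + energy p h S)"
    unfolding energy_def by (subst nn_integral_cmult, simp, subst nn_integral_add) auto
  finally show ?thesis .
qed

text \<open>
Let \<open>A\<close> and \<open>E\<close> be the energies of \<open>w\<close> and \<open>g\<close> on the ball. For each \<open>y \<in> D\<close> near \<open>z\<close> the
ordinary Poincare inequality bounds \<open>A\<close> by \<open>\<rho>^p E\<close> plus a term with the average of \<open>w\<close> about \<open>y\<close>.
Either the first term already dominates, or all these averages are large compared with \<open>A\<close>; then the
content bound, with thickness as a lower bound of the content, estimates them by \<open>E\<close>.
\<close>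

theorem thick_poincare:
  fixes D :: "(real^'n) set"
  assumes thick: "thick l D" and l: "real CARD('n) - p < l" and p: "1 \<le> p"
  obtains R C where "0 < R" "0 < C"
    "\<And>w g z \<rho>. upper_gradient w g \<Longrightarrow> (\<And>y. y \<in> D \<Longrightarrow> w y = 0) \<Longrightarrow> z \<in> D \<Longrightarrow> 0 < \<rho> \<Longrightarrow> \<rho> \<le> R \<Longrightarrow>
       energy p w (ball z (2 * \<rho>)) \<le> ennreal (C * \<rho> powr p) * energy p g (ball z (2 * \<rho>))"
proof -
  define n where "n = CARD('n)"
  have l0: "0 < l" using thick by (simp add: thick_def)
  obtain R \<gamma> where R: "0 < R" and \<gamma>: "0 < \<gamma>"
    and con: "\<And>z r. z \<in> D \<Longrightarrow> 0 < r \<Longrightarrow> r \<le> R \<Longrightarrow> ennreal (\<gamma> * r powr l) \<le> hausdorff_content l (D \<inter> ball z r)"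
    using thick unfolding thick_def by (metis greaterThanAtMost_iff)
  define c where "c = 2 powr p * 4 ^ CARD('n) / unit_ball_vol CARD('n) *
      (2 / (1 - 2 powr (- (l - CARD('n) + p) / p))) powr p"
  have c: "0 \<le> c" by (simp add: c_def)
  define C1 where "C1 = 4 powr p * 4 ^ n"
  have C1: "0 < C1" by (simp add: C1_def)
  define V where "V = unit_ball_vol n * 2 ^ n"
  have V: "0 < V" by (simp add: V_def)
  define C where "C = 2 * (2 powr p * C1) + 2 * (2 powr p * V) * (5 powr l * c / \<gamma>)"
  have C: "0 < C" using C1 V c \<gamma> by (auto simp: C_def intro!: add_pos_nonneg)
  show thesis
  proof (rule that[OF R C])
    fix w g :: "real^'n \<Rightarrow> real" and z \<rho>
    assume ug: "upper_gradient w g" and w0: "\<And>y. y \<in> D \<Longrightarrow> w y = 0"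
      and z: "z \<in> D" and \<rho>: "0 < \<rho>" "\<rho> \<le> R"
    let ?K = "ball z (2 * \<rho>)"
    have cont: "continuous_on UNIV w" "continuous_on UNIV g" using ug by (auto simp: upper_gradient_def)
    then have [measurable]: "w \<in> borel_measurable borel" by (auto intro: borel_measurable_continuous_onI)
    define A E where "A = enn2real (energy p w ?K)" and "E = enn2real (energy p g ?K)"
    have A: "energy p w ?K = ennreal A" and E: "energy p g ?K = ennreal E"
      using energy_finite[OF cont(1), of ?K p] energy_finite[OF cont(2), of ?K p] p
      by (auto simp: A_def E_def)
    have E0: "0 \<le> E" "0 \<le> A" by (auto simp: E_def A_def)
    have upper: "A \<le> 2 powr p * (C1 * \<rho> powr p * E) + 2 powr p * (V * \<rho> powr n * \<bar>ball_average w y \<rho>\<bar> powr p)"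
      if y: "y \<in> D \<inter> ball z \<rho>" for y
    proof -
      define a where "a = ball_average w y \<rho>"
      have sub: "ball y \<rho> \<subseteq> ?K"
      proof
        fix x assume "x \<in> ball y \<rho>"
        then show "x \<in> ?K" using y dist_triangle[of z x y] by simp
      qed
      have "energy p (\<lambda>x. (w x - a) + a) ?K \<le> ennreal (2 powr p) * (energy p (\<lambda>x. w x - a) ?K + energy p (\<lambda>x. a) ?K)"
        using p by (intro energy_add_le) auto
      also have "energy p (\<lambda>x. a) ?K = ennreal (V * \<rho> powr n * \<bar>a\<bar> powr p)"
      proof -
        have "energy p (\<lambda>x. a) ?K = ennreal (\<bar>a\<bar> powr p) * emeasure lborel ?K"
          unfolding energy_def by (rule nn_integral_cmult_indicator) simp
        also have "\<dots> = ennreal (V * \<rho> powr n * \<bar>a\<bar> powr p)"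
          using \<rho> unfolding ennreal_measure_ball[symmetric]
          by (simp add: ennreal_mult'[symmetric] content_ball V_def n_def powr_realpow power_mult_distrib mult_ac)
        finally show ?thesis .
      qed
      also have "energy p (\<lambda>x. w x - a) ?K \<le> ennreal ((2 * (2 * \<rho>)) powr p * (2 * (2 * \<rho>) / \<rho>) ^ DIM(real^'n)) * energy p g ?K"
        unfolding a_def by (rule poincare_ball_average[OF ug p \<rho>(1) sub])
      also have "(2 * (2 * \<rho>)) powr p * (2 * (2 * \<rho>) / \<rho>) ^ DIM(real^'n) = C1 * \<rho> powr p"
        using \<rho> by (simp add: C1_def n_def powr_mult)
      finally have "ennreal A \<le> ennreal (2 powr p) * (ennreal (C1 * \<rho> powr p) * ennreal E + ennreal (V * \<rho> powr n * \<bar>a\<bar> powr p))"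
        by (simp add: A E add_right_mono mult_left_mono)
      also have "\<dots> = ennreal (2 powr p * (C1 * \<rho> powr p * E) + 2 powr p * (V * \<rho> powr n * \<bar>a\<bar> powr p))"
        using C1 V E0 by (simp add: ennreal_mult'[symmetric] ennreal_plus[symmetric] distrib_left del: ennreal_plus)
      finally show ?thesis
        using C1 V E0 by (subst (asm) ennreal_le_iff) (auto simp: a_def)
    qed
    have "A \<le> C * \<rho> powr p * E"
    proof (cases "A \<le> 2 * (2 powr p * (C1 * \<rho> powr p * E))")
      case True
      have "0 \<le> 2 * (2 powr p * V) * (5 powr l * c / \<gamma>) * \<rho> powr p * E"
        using V c \<gamma> E0 by auto
      then show ?thesis using True by (simp add: C_def algebra_simps)
    next
      case False
      \<comment> \<open>If the first term in \<open>upper\<close> does not dominate, \<open>q\<close> is the resulting lower bound for the \<open>p\<close>-th powers of all averages.\<close>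
      define q where "q = A / (2 * (2 powr p * (V * \<rho> powr n)))"
      have A0: "0 < A" using False C1 E0 by (smt (verit) mult_nonneg_nonneg powr_ge_zero)
      have q: "0 < q" using A0 V \<rho> by (simp add: q_def)
      define m where "m = q powr (1 / p)"
      have m: "0 < m" "m powr p = q" using q p by (auto simp: m_def powr_powr)
      have low: "m \<le> \<bar>ball_average w y \<rho>\<bar>" if "y \<in> D \<inter> ball z \<rho>" for y
      proof -
        have "A \<le> 2 * (2 powr p * (V * \<rho> powr n * \<bar>ball_average w y \<rho>\<bar> powr p))"
          using upper[OF that] False by linarith
        then have "q \<le> \<bar>ball_average w y \<rho>\<bar> powr p"
          using V \<rho> by (simp add: q_def divide_le_eq mult_ac)
        then have "m \<le> (\<bar>ball_average w y \<rho>\<bar> powr p) powr (1 / p)"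
          unfolding m_def using q p by (intro powr_mono2) auto
        then show ?thesis using p by (simp add: powr_powr)
      qed
      have zF: "D \<inter> ball z \<rho> \<noteq> {}" using z \<rho> by auto
      have "ennreal q * ennreal (\<gamma> * \<rho> powr l) \<le> ennreal (m powr p) * hausdorff_content l (D \<inter> ball z \<rho>)"
        unfolding m(2) by (intro mult_left_mono con z \<rho>) auto
      also have "\<dots> \<le> ennreal (5 powr l * c * \<rho> powr (l - CARD('n) + p)) * energy p g ?K"
        by (rule content_average_bound[OF ug p \<rho>(1) zF _ _ l0 l m(1) low c_def]) (use w0 in auto)
      finally have "q * (\<gamma> * \<rho> powr l) \<le> 5 powr l * c * \<rho> powr (l - n + p) * E"
        using q c \<gamma> E0 unfolding E by (simp add: ennreal_mult'[symmetric] n_def)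
      also have "\<rho> powr (l - n + p) = \<rho> powr l * \<rho> powr (p - n)"
        using \<rho> by (simp add: powr_add[symmetric] algebra_simps)
      finally have "\<rho> powr l * (q * \<gamma>) \<le> \<rho> powr l * (5 powr l * c * \<rho> powr (p - n) * E)"
        by (simp add: mult_ac)
      then have "q * \<gamma> \<le> 5 powr l * c * \<rho> powr (p - n) * E"
        using \<rho> by simp
      then have qle: "q \<le> (5 powr l * c / \<gamma>) * \<rho> powr (p - n) * E"
        using \<gamma> by (simp add: field_simps)
      have "A = 2 * (2 powr p * V) * \<rho> powr n * q"
        using V \<rho> by (simp add: q_def)
      also have "\<dots> \<le> 2 * (2 powr p * V) * \<rho> powr n * ((5 powr l * c / \<gamma>) * \<rho> powr (p - n) * E)"
        using V by (intro mult_left_mono qle) auto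
      also have "\<dots> = 2 * (2 powr p * V) * (5 powr l * c / \<gamma>) * (\<rho> powr n * \<rho> powr (p - n)) * E"
        by (simp only: mult_ac)
      also have "\<rho> powr n * \<rho> powr (p - n) = \<rho> powr p" using \<rho> by (simp add: powr_add[symmetric])
      also have "2 * (2 powr p * V) * (5 powr l * c / \<gamma>) * \<rho> powr p * E \<le> C * \<rho> powr p * E"
        using C1 E0 by (intro mult_right_mono) (auto simp: C_def)
      finally show ?thesis .
    qed
    then show "energy p w ?K \<le> ennreal (C * \<rho> powr p) * energy p g ?K"
      unfolding A E using C E0 by (subst ennreal_mult'[symmetric]) (auto intro!: ennreal_leI)
  qed
qed

section \<open>Weighted estimates near the vanishing set\<close>

text \<open>
The inequality on balls is integrated over all centres \<open>x\<close> with \<open>infdist x D < \<rho>\<close>, using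
\<open>ball x \<rho> \<subseteq> ball z (2 * \<rho>) \<subseteq> ball x (3 * \<rho>)\<close> for a point \<open>z \<in> D\<close> close to \<open>x\<close>. By Fubini's
theorem each point is weighted with the volume of the centres whose ball contains it. On the left, each point at distance less than
\<open>\<rho> / 2\<close> from \<open>D\<close> has at least a ball of radius \<open>\<rho> / 2\<close> of such centres, on the right every point
has at most a ball of radius \<open>3 * \<rho>\<close>, whence the factor \<open>6 ^ d\<close>.
\<close>

lemma neighbourhood_estimate:
  fixes w g :: "'a::euclidean_space \<Rightarrow> real"
  assumes [measurable]: "w \<in> borel_measurable borel" "g \<in> borel_measurable borel"
    and D: "D \<noteq> {}" and \<rho>: "0 < \<rho>" and M: "0 \<le> M"
    and loc: "\<And>z. z \<in> D \<Longrightarrow> energy p w (ball z (2 * \<rho>)) \<le> ennreal M * energy p g (ball z (2 * \<rho>))"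
  shows "energy p w {x. infdist x D < \<rho> / 2} \<le> ennreal (6 ^ DIM('a) * M) * energy p g {x. infdist x D < 4 * \<rho>}"
proof -
  define U where "U = {x. infdist x D < \<rho>}"
  define U1 where "U1 = {x. infdist x D < \<rho> / 2}"
  define U4 where "U4 = {x. infdist x D < 4 * \<rho>}"
  have [measurable]: "(\<lambda>x. infdist x D) \<in> borel_measurable borel"
    by (intro borel_measurable_continuous_onI continuous_intros)
  have [measurable]: "U \<in> sets borel" "U1 \<in> sets borel" "U4 \<in> sets borel"
    unfolding U_def U1_def U4_def by measurable
  define W G where "W = (\<lambda>x. ennreal (\<bar>w x\<bar> powr p))" and "G = (\<lambda>x. ennreal (\<bar>g x\<bar> powr p))"
  have [measurable]: "W \<in> borel_measurable borel" "G \<in> borel_measurable borel"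
    unfolding W_def G_def by measurable
  define \<omega> where "\<omega> = unit_ball_vol DIM('a)"
  have \<omega>: "0 < \<omega>" by (simp add: \<omega>_def)
  \<comment> \<open>The indicator of a ball as a function of centre and point, jointly measurable in both.\<close>
  define I where "I = (\<lambda>(r::real) (x::'a) y. if dist x y < r then 1 else 0 :: ennreal)"
  have I_meas[measurable]: "(\<lambda>(x, y). I r x y) \<in> borel_measurable (borel \<Otimes>\<^sub>M borel)" for r
    unfolding I_def by measurable
  have I_ball: "I r x y = indicator (ball x r) y" "I r x y = indicator (ball y r) x" for r x y
    by (auto simp: I_def indicator_def dist_commute)
  have enW: "energy p w (ball x r) = (\<integral>\<^sup>+y. W y * I r x y \<partial>lborel)"
    and enG: "energy p g (ball x r) = (\<integral>\<^sup>+y. G y * I r x y \<partial>lborel)" for x r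
    by (simp_all add: energy_def W_def G_def I_ball(1))
  have vol: "(\<integral>\<^sup>+x. indicator (ball y r) x \<partial>lborel) = ennreal (\<omega> * r ^ DIM('a))" if "0 \<le> r" for y :: 'a and r
    using that by (simp add: emeasure_ball \<omega>_def)
  have local: "energy p w (ball x \<rho>) \<le> ennreal M * energy p g (ball x (3 * \<rho>))" if x: "x \<in> U" for x
  proof -
    obtain z where z: "z \<in> D" "dist x z < \<rho>"
      using x D cINF_less_iff[of D "dist x" \<rho>] by (auto simp: U_def infdist_def)
    have "ball x \<rho> \<subseteq> ball z (2 * \<rho>)"
    proof
      fix y assume "y \<in> ball x \<rho>"
      then show "y \<in> ball z (2 * \<rho>)" using z(2) dist_triangle[of z y x] by (simp add: dist_commute)
    qed
    moreover have "ball z (2 * \<rho>) \<subseteq> ball x (3 * \<rho>)"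
    proof
      fix y assume "y \<in> ball z (2 * \<rho>)"
      then show "y \<in> ball x (3 * \<rho>)" using z(2) dist_triangle[of x y z] by (simp add: dist_commute)
    qed
    ultimately show ?thesis
      by (meson order_trans energy_mono loc[OF z(1)] mult_left_mono zero_le)
  qed
  have lower: "ennreal (\<omega> * (\<rho> / 2) ^ DIM('a)) * energy p w U1
      \<le> (\<integral>\<^sup>+x. energy p w (ball x \<rho>) * indicator U x \<partial>lborel)"
  proof -
    have "(\<integral>\<^sup>+x. energy p w (ball x \<rho>) * indicator U x \<partial>lborel)
      = (\<integral>\<^sup>+x. (\<integral>\<^sup>+y. W y * I \<rho> x y * indicator U x \<partial>lborel) \<partial>lborel)"
      unfolding enW by (intro nn_integral_cong nn_integral_multc[symmetric]) measurable
    also have "\<dots> = (\<integral>\<^sup>+y. (\<integral>\<^sup>+x. W y * I \<rho> x y * indicator U x \<partial>lborel) \<partial>lborel)"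
      by (rule lborel_pair.Fubini'[symmetric]) measurable
    also have "\<dots> \<ge> (\<integral>\<^sup>+y. ennreal (\<omega> * (\<rho> / 2) ^ DIM('a)) * (W y * indicator U1 y) \<partial>lborel)"
    proof (rule nn_integral_mono)
      fix y :: 'a
      show "ennreal (\<omega> * (\<rho> / 2) ^ DIM('a)) * (W y * indicator U1 y)
          \<le> (\<integral>\<^sup>+x. W y * I \<rho> x y * indicator U x \<partial>lborel)"
      proof (cases "y \<in> U1")
        case True
        have "x \<in> U" if "x \<in> ball y (\<rho> / 2)" for x
          using that True infdist_triangle[of x D y] by (simp add: U_def U1_def dist_commute)
        then have "(\<integral>\<^sup>+x. W y * indicator (ball y (\<rho> / 2)) x \<partial>lborel) \<le> (\<integral>\<^sup>+x. W y * I \<rho> x y * indicator U x \<partial>lborel)"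
          using \<rho> by (intro nn_integral_mono) (auto simp: I_def indicator_def dist_commute)
        then show ?thesis using True \<rho> vol[of "\<rho> / 2" y] by (simp add: nn_integral_cmult_indicator mult.commute)
      qed simp
    qed
    also have "(\<integral>\<^sup>+y. ennreal (\<omega> * (\<rho> / 2) ^ DIM('a)) * (W y * indicator U1 y) \<partial>lborel)
        = ennreal (\<omega> * (\<rho> / 2) ^ DIM('a)) * energy p w U1"
      by (simp add: energy_def W_def nn_integral_cmult)
    finally show ?thesis .
  qed
  have upper: "(\<integral>\<^sup>+x. energy p g (ball x (3 * \<rho>)) * indicator U x \<partial>lborel)
      \<le> ennreal (\<omega> * (3 * \<rho>) ^ DIM('a)) * energy p g U4"
  proof -
    have "(\<integral>\<^sup>+x. energy p g (ball x (3 * \<rho>)) * indicator U x \<partial>lborel)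
      = (\<integral>\<^sup>+x. (\<integral>\<^sup>+y. G y * I (3 * \<rho>) x y * indicator U x \<partial>lborel) \<partial>lborel)"
      unfolding enG by (intro nn_integral_cong nn_integral_multc[symmetric]) measurable
    also have "\<dots> = (\<integral>\<^sup>+y. (\<integral>\<^sup>+x. G y * I (3 * \<rho>) x y * indicator U x \<partial>lborel) \<partial>lborel)"
      by (rule lborel_pair.Fubini'[symmetric]) measurable
    also have "\<dots> \<le> (\<integral>\<^sup>+y. ennreal (\<omega> * (3 * \<rho>) ^ DIM('a)) * (G y * indicator U4 y) \<partial>lborel)"
    proof (rule nn_integral_mono)
      fix y :: 'a
      have "(\<integral>\<^sup>+x. G y * I (3 * \<rho>) x y * indicator U x \<partial>lborel)
         \<le> (\<integral>\<^sup>+x. G y * indicator U4 y * indicator (ball y (3 * \<rho>)) x \<partial>lborel)"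
      proof (rule nn_integral_mono)
        fix x :: 'a
        have "y \<in> U4" if "x \<in> U" "dist x y < 3 * \<rho>"
          using that infdist_triangle[of y D x] by (simp add: U_def U4_def dist_commute)
        then show "G y * I (3 * \<rho>) x y * indicator U x \<le> G y * indicator U4 y * indicator (ball y (3 * \<rho>)) x"
          by (auto simp: I_def indicator_def dist_commute)
      qed
      also have "\<dots> = ennreal (\<omega> * (3 * \<rho>) ^ DIM('a)) * (G y * indicator U4 y)"
        using vol[of "3 * \<rho>" y] \<rho> by (simp add: nn_integral_cmult_indicator mult.commute)
      finally show "(\<integral>\<^sup>+x. G y * I (3 * \<rho>) x y * indicator U x \<partial>lborel)
          \<le> ennreal (\<omega> * (3 * \<rho>) ^ DIM('a)) * (G y * indicator U4 y)" .
    qed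
    also have "\<dots> = ennreal (\<omega> * (3 * \<rho>) ^ DIM('a)) * energy p g U4"
      by (simp add: energy_def G_def nn_integral_cmult)
    finally show ?thesis .
  qed
  have meas[measurable]: "(\<lambda>x. energy p g (ball x (3 * \<rho>))) \<in> borel_measurable borel"
    unfolding energy_def I_ball(1)[symmetric] by measurable
  have "ennreal (\<omega> * (\<rho> / 2) ^ DIM('a)) * energy p w U1
      \<le> (\<integral>\<^sup>+x. ennreal M * (energy p g (ball x (3 * \<rho>)) * indicator U x) \<partial>lborel)"
    using local by (intro order_trans[OF lower] nn_integral_mono) (auto simp: indicator_def)
  also have "\<dots> = ennreal M * (\<integral>\<^sup>+x. energy p g (ball x (3 * \<rho>)) * indicator U x \<partial>lborel)"
    by (rule nn_integral_cmult) measurable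
  also have "\<dots> \<le> ennreal M * (ennreal (\<omega> * (3 * \<rho>) ^ DIM('a)) * energy p g U4)"
    by (intro mult_left_mono upper) auto
  finally have 1: "ennreal (\<omega> * (\<rho> / 2) ^ DIM('a)) * energy p w U1
     \<le> ennreal M * (ennreal (\<omega> * (3 * \<rho>) ^ DIM('a)) * energy p g U4)" .
  define k where "k = 1 / (\<omega> * (\<rho> / 2) ^ DIM('a))"
  have k: "0 < k" "k * (\<omega> * (\<rho> / 2) ^ DIM('a)) = 1" using \<omega> \<rho> by (auto simp: k_def)
  have "energy p w U1 = ennreal k * (ennreal (\<omega> * (\<rho> / 2) ^ DIM('a)) * energy p w U1)"
    using k \<omega> by (simp add: mult.assoc[symmetric] ennreal_mult'[symmetric])
  also have "\<dots> \<le> ennreal k * (ennreal M * (ennreal (\<omega> * (3 * \<rho>) ^ DIM('a)) * energy p g U4))"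
    by (intro mult_left_mono 1) auto
  also have "\<dots> = ennreal (k * M * (\<omega> * (3 * \<rho>) ^ DIM('a))) * energy p g U4"
    using k(1) M \<omega> \<rho> by (simp only: mult.assoc[symmetric] ennreal_mult'[symmetric] less_imp_le mult_nonneg_nonneg)
  also have "k * M * (\<omega> * (3 * \<rho>) ^ DIM('a)) = 6 ^ DIM('a) * M"
  proof -
    have "(6::real) ^ DIM('a) = (3 * \<rho>) ^ DIM('a) / (\<rho> / 2) ^ DIM('a)"
    proof -
      have "3 * \<rho> / (\<rho> / 2) = 6" using \<rho> by simp
      then show ?thesis by (simp only: power_divide[symmetric])
    qed
    then show ?thesis using \<omega> by (simp add: k_def)
  qed
  finally show ?thesis by (simp add: U1_def U4_def)
qed

text \<open>
An increasing geometric sequence cut off at height \<open>T\<close> has a sum of the order of its largest term.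
The minimum in the induction covers the stages before and after the cut.
\<close>

lemma truncated_geometric_sum:
  fixes a s T :: real
  assumes a: "0 < a" and s: "1 < s" and T: "0 \<le> T"
  shows "(\<Sum>k. ennreal (if a * s ^ k < T then a * s ^ k else 0)) \<le> ennreal (T * s / (s - 1))"
proof (rule suminf_le_const[OF summableI])
  fix N
  let ?f = "\<lambda>k. if a * s ^ k < T then a * s ^ k else 0"
  have "(\<Sum>k<N. ?f k) \<le> min (T * s) (a * s ^ N) / (s - 1)"
  proof (induction N)
    case 0
    then show ?case using a s T by simp
  next
    case (Suc N)
    show ?case
    proof (cases "a * s ^ N < T")
      case True
      have "(\<Sum>k<Suc N. ?f k) \<le> a * s ^ N / (s - 1) + a * s ^ N"
        using order_trans[OF Suc divide_right_mono[OF min.cobounded2]] True s by simp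
      also have "\<dots> = a * s ^ Suc N / (s - 1)"
        using s by (simp add: field_simps)
      also have "\<dots> = min (T * s) (a * s ^ Suc N) / (s - 1)"
        using True s by (simp add: min_def mult.assoc[symmetric] mult.commute[of s])
      finally show ?thesis .
    next
      case False
      have "a * s ^ N \<le> a * s ^ Suc N" using a s by simp
      then have "min (T * s) (a * s ^ N) \<le> min (T * s) (a * s ^ Suc N)" by (simp only: min.mono order_refl)
      then show ?thesis using Suc False s by (simp add: divide_right_mono order_trans[OF Suc])
    qed
  qed
  also have "\<dots> \<le> T * s / (s - 1)" using s by (intro divide_right_mono) auto
  finally show "(\<Sum>k<N. ennreal (?f k)) \<le> ennreal (T * s / (s - 1))"
    using a s by (subst sum_ennreal) (auto intro!: ennreal_leI)
qed

text \<open>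
The constant of the geometric sum with ratio \<open>2 powr b\<close> grows no faster than \<open>1 / b\<close>. This rate
matters later, when \<open>b powr p / b\<close> has to become small.
\<close>

lemma two_powr_minus_one_ge:
  fixes b :: real
  assumes "0 < b" "b \<le> 1"
  shows "2 powr b / (2 powr b - 1) \<le> 4 / b"
proof -
  have "1 + b * ln 2 \<le> 2 powr b" using exp_ge_add_one_self[of "b * ln 2"] by (simp add: powr_def)
  moreover have "b * (1/2) \<le> b * ln 2" using assms ln2_ge_two_thirds by (intro mult_left_mono) auto
  ultimately have "b / 2 \<le> 2 powr b - 1" by simp
  moreover have "2 powr b \<le> 2 powr (1::real)" using assms by (intro powr_mono) auto
  ultimately have "2 powr b / (2 powr b - 1) \<le> 2 / (b / 2)" using assms by (intro frac_le) auto
  then show ?thesis by simp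
qed

lemma dyadic_scale:
  fixes R t :: real
  assumes "0 < t" "t < R / 2"
  obtains k :: nat where "t < R / 2 ^ k / 2" "R / 2 ^ k \<le> 4 * t"
proof -
  define P where "P = (\<lambda>k::nat. R / 2 ^ k / 2 \<le> t)"
  obtain n where "R / (2 * t) < 2 ^ n" using real_arch_pow[of 2 "R / (2 * t)"] by auto
  then have "P n" using assms by (simp add: P_def field_simps)
  define m where "m = (LEAST k. P k)"
  have "P m" unfolding m_def using \<open>P n\<close> by (rule LeastI)
  have "m \<noteq> 0" using \<open>P m\<close> assms by (auto simp: P_def intro: ccontr)
  then obtain k where k: "m = Suc k" by (cases m) auto
  have "\<not> P k" using k not_less_Least[of k P] by (simp add: m_def)
  then show thesis using \<open>P m\<close> k by (intro that[of k]) (auto simp: P_def)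
qed

text \<open>
The estimates for \<open>\<rho> = R / 2 ^ k\<close> are multiplied by \<open>\<rho> powr (- p - b)\<close> and added. For a point \<open>x\<close>
on the left side, one scale \<open>\<rho>\<close> comparable to \<open>\<delta> x\<close> suffices (\<open>dyadic_scale\<close>). On the right side
all scales above \<open>\<delta> x / 4\<close> contribute, with weights \<open>\<rho> powr (- b)\<close> whose sum is at most a multiple of
\<open>\<delta> x powr (- b) / b\<close>. At points with \<open>\<delta> x = 0\<close> the power \<open>\<delta> x powr (- b)\<close> is \<open>0\<close> by convention, so
\<open>g\<close> has to vanish there.
\<close>

lemma weighted_estimate:
  fixes w g \<delta> :: "'a::euclidean_space \<Rightarrow> real"
  assumes [measurable]: "w \<in> borel_measurable borel" "g \<in> borel_measurable borel" "\<delta> \<in> borel_measurable borel"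
    and \<delta>: "\<And>x. 0 \<le> \<delta> x" and g0: "\<And>x. \<delta> x = 0 \<Longrightarrow> g x = 0"
    and R: "0 < R" and C: "0 \<le> C" and p: "1 \<le> p" and b: "0 < b" "b \<le> 1"
    and est: "\<And>\<rho>. 0 < \<rho> \<Longrightarrow> \<rho> \<le> R \<Longrightarrow>
      energy p w {x. \<delta> x < \<rho> / 2} \<le> ennreal (C * \<rho> powr p) * energy p g {x. \<delta> x < 4 * \<rho>}"
  shows "(\<integral>\<^sup>+x. ennreal (\<bar>w x\<bar> powr p * \<delta> x powr (- p - b)) * indicator {x. \<delta> x < R / 2} x \<partial>lborel)
    \<le> ennreal (C * 4 powr (p + 3) / b) * (\<integral>\<^sup>+x. ennreal (\<bar>g x\<bar> powr p * \<delta> x powr (- b)) \<partial>lborel)"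
proof -
  define \<rho> where "\<rho> = (\<lambda>k::nat. R / 2 ^ k)"
  have \<rho>: "0 < \<rho> k" "\<rho> k \<le> R" for k using R by (auto simp: \<rho>_def divide_le_eq)
  define L where "L = ennreal (4 powr (p + b))"
  have pt: "ennreal (\<bar>w x\<bar> powr p * \<delta> x powr (- p - b)) * indicator {x. \<delta> x < R / 2} x
    \<le> (\<Sum>k. L * (ennreal (\<rho> k powr (- p - b)) * (ennreal (\<bar>w x\<bar> powr p) * indicator {x. \<delta> x < \<rho> k / 2} x)))" for x
  proof (cases "0 < \<delta> x \<and> \<delta> x < R / 2")
    case True
    then obtain k where k: "\<delta> x < \<rho> k / 2" "\<rho> k \<le> 4 * \<delta> x" by (auto simp: \<rho>_def elim: dyadic_scale)
    have "(4 * \<delta> x) powr (- p - b) \<le> \<rho> k powr (- p - b)"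
      using k \<rho>[of k] p b by (intro powr_mono2') auto
    then have "4 powr (p + b) * (4 * \<delta> x) powr (- p - b) \<le> 4 powr (p + b) * \<rho> k powr (- p - b)"
      by (intro mult_left_mono) auto
    moreover have "4 powr (p + b) * (4 * \<delta> x) powr (- p - b) = \<delta> x powr (- p - b)"
    proof -
      have "(4::real) powr (p + b) * 4 powr (- p - b) = 1" by (simp add: powr_add[symmetric])
      then show ?thesis by (simp add: powr_mult)
    qed
    ultimately have "\<bar>w x\<bar> powr p * \<delta> x powr (- p - b) \<le> \<bar>w x\<bar> powr p * (4 powr (p + b) * \<rho> k powr (- p - b))"
      by (intro mult_left_mono) auto
    then have "ennreal (\<bar>w x\<bar> powr p * \<delta> x powr (- p - b))
      \<le> L * (ennreal (\<rho> k powr (- p - b)) * ennreal (\<bar>w x\<bar> powr p))"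
      by (simp add: L_def ennreal_mult'[symmetric] mult_ac ennreal_leI)
    then have "ennreal (\<bar>w x\<bar> powr p * \<delta> x powr (- p - b)) * indicator {x. \<delta> x < R / 2} x
      \<le> L * (ennreal (\<rho> k powr (- p - b)) * (ennreal (\<bar>w x\<bar> powr p) * indicator {x. \<delta> x < \<rho> k / 2} x))"
      using True k by simp
    also have "\<dots> \<le> (\<Sum>k. L * (ennreal (\<rho> k powr (- p - b)) * (ennreal (\<bar>w x\<bar> powr p) * indicator {x. \<delta> x < \<rho> k / 2} x)))"
      using sum_le_suminf[OF summableI, of "{k}" "\<lambda>k. L * (ennreal (\<rho> k powr (- p - b)) * (ennreal (\<bar>w x\<bar> powr p) * indicator {x. \<delta> x < \<rho> k / 2} x))"] by simp
    finally show ?thesis .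
  next
    case False
    then show ?thesis using \<delta>[of x] by (auto simp: indicator_def)
  qed
  have geo: "(\<Sum>k. ennreal (\<rho> k powr (- b)) * (ennreal (\<bar>g x\<bar> powr p) * indicator {x. \<delta> x < 4 * \<rho> k} x))
     \<le> ennreal (4 powr 2 / b) * ennreal (\<bar>g x\<bar> powr p * \<delta> x powr (- b))" for x
  proof (cases "\<delta> x = 0")
    case True
    then show ?thesis using g0[OF True] p by simp
  next
    case False
    with \<delta>[of x] have dx: "0 < \<delta> x" by simp
    define T where "T = (\<delta> x / 4) powr (- b)"
    have eq: "\<rho> k powr (- b) = R powr (- b) * (2 powr b) ^ k" for k
    proof -
      have "\<rho> k powr (- b) = R powr (- b) / (2 powr (real k)) powr (- b)"
        by (simp add: \<rho>_def powr_divide powr_realpow)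
      also have "(2 powr (real k)) powr (- b) = 1 / (2 powr b) ^ k"
        by (simp add: powr_powr powr_minus divide_inverse powr_realpow[symmetric] mult.commute)
      finally show ?thesis by simp
    qed
    have iff: "\<delta> x < 4 * \<rho> k \<Longrightarrow> \<rho> k powr (- b) < T" for k
      unfolding T_def using \<rho>[of k] dx b by (intro powr_less_mono2_neg) auto
    have "(\<Sum>k. ennreal (\<rho> k powr (- b)) * (ennreal (\<bar>g x\<bar> powr p) * indicator {x. \<delta> x < 4 * \<rho> k} x))
      \<le> (\<Sum>k. ennreal (\<bar>g x\<bar> powr p) * ennreal (if R powr (- b) * (2 powr b) ^ k < T then R powr (- b) * (2 powr b) ^ k else 0))"
      using iff by (intro suminf_le allI) (auto simp: indicator_def eq mult.commute)
    also have "\<dots> = ennreal (\<bar>g x\<bar> powr p) * (\<Sum>k. ennreal (if R powr (- b) * (2 powr b) ^ k < T then R powr (- b) * (2 powr b) ^ k else 0))"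
      by (rule ennreal_suminf_cmult)
    also have "\<dots> \<le> ennreal (\<bar>g x\<bar> powr p) * ennreal (T * 2 powr b / (2 powr b - 1))"
      using R b by (intro mult_left_mono truncated_geometric_sum) (auto simp: T_def)
    also have "\<dots> = ennreal (\<bar>g x\<bar> powr p * (T * (2 powr b / (2 powr b - 1))))"
      by (simp add: ennreal_mult'[symmetric])
    also have "\<dots> \<le> ennreal (\<bar>g x\<bar> powr p * ((4 * \<delta> x powr (- b)) * (4 / b)))"
    proof (intro ennreal_leI mult_left_mono mult_mono two_powr_minus_one_ge b)
      have "T = 4 powr b * \<delta> x powr (- b)" by (simp add: T_def powr_divide powr_minus_divide)
      moreover have "4 powr b \<le> 4 powr (1::real)" using b by (intro powr_mono) auto
      ultimately show "T \<le> 4 * \<delta> x powr (- b)" by (simp add: mult_right_mono)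
      show "0 \<le> 2 powr b / (2 powr b - 1)" 
      proof (rule divide_nonneg_pos)
        show "0 < 2 powr b - 1" using gr_one_powr[of 2 b] b by (simp only: diff_gt_0_iff_gt)
      qed simp
    qed auto
    also have "\<dots> = ennreal (4 powr 2 / b) * ennreal (\<bar>g x\<bar> powr p * \<delta> x powr (- b))"
      using b by (simp add: ennreal_mult'[symmetric] mult_ac)
    finally show ?thesis .
  qed
  have "(\<integral>\<^sup>+x. ennreal (\<bar>w x\<bar> powr p * \<delta> x powr (- p - b)) * indicator {x. \<delta> x < R / 2} x \<partial>lborel)
    \<le> (\<integral>\<^sup>+x. (\<Sum>k. L * (ennreal (\<rho> k powr (- p - b)) * (ennreal (\<bar>w x\<bar> powr p) * indicator {x. \<delta> x < \<rho> k / 2} x))) \<partial>lborel)"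
    by (intro nn_integral_mono pt)
  also have "\<dots> = (\<Sum>k. L * (ennreal (\<rho> k powr (- p - b)) * energy p w {x. \<delta> x < \<rho> k / 2}))"
    unfolding energy_def by (subst nn_integral_suminf, measurable) (simp add: nn_integral_cmult)
  also have "\<dots> \<le> (\<Sum>k. (L * ennreal C) * (ennreal (\<rho> k powr (- b)) * energy p g {x. \<delta> x < 4 * \<rho> k}))"
  proof (intro suminf_le allI summableI)
    fix k
    have "L * (ennreal (\<rho> k powr (- p - b)) * energy p w {x. \<delta> x < \<rho> k / 2})
      \<le> L * (ennreal (\<rho> k powr (- p - b)) * (ennreal (C * \<rho> k powr p) * energy p g {x. \<delta> x < 4 * \<rho> k}))"
      by (intro mult_left_mono est \<rho>) auto
    also have "\<dots> = L * (ennreal (\<rho> k powr (- p - b) * (C * \<rho> k powr p)) * energy p g {x. \<delta> x < 4 * \<rho> k})"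
      using C by (subst ennreal_mult) (auto simp: mult.assoc)
    also have "\<rho> k powr (- p - b) * (C * \<rho> k powr p) = C * \<rho> k powr (- b)"
      using \<rho>[of k] by (simp add: powr_add[symmetric])
    finally show "L * (ennreal (\<rho> k powr (- p - b)) * energy p w {x. \<delta> x < \<rho> k / 2})
      \<le> (L * ennreal C) * (ennreal (\<rho> k powr (- b)) * energy p g {x. \<delta> x < 4 * \<rho> k})"
      using C by (simp add: ennreal_mult mult_ac)
  qed
  also have "\<dots> = (L * ennreal C) * (\<Sum>k. ennreal (\<rho> k powr (- b)) * energy p g {x. \<delta> x < 4 * \<rho> k})"
    by (rule ennreal_suminf_cmult)
  also have "(\<Sum>k. ennreal (\<rho> k powr (- b)) * energy p g {x. \<delta> x < 4 * \<rho> k})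
      = (\<integral>\<^sup>+x. (\<Sum>k. ennreal (\<rho> k powr (- b)) * (ennreal (\<bar>g x\<bar> powr p) * indicator {x. \<delta> x < 4 * \<rho> k} x)) \<partial>lborel)"
    unfolding energy_def by (subst nn_integral_suminf, measurable) (simp add: nn_integral_cmult)
  also have "\<dots> \<le> (\<integral>\<^sup>+x. ennreal (4 powr 2 / b) * ennreal (\<bar>g x\<bar> powr p * \<delta> x powr (- b)) \<partial>lborel)"
    by (intro nn_integral_mono geo)
  also have "\<dots> = ennreal (4 powr 2 / b) * (\<integral>\<^sup>+x. ennreal (\<bar>g x\<bar> powr p * \<delta> x powr (- b)) \<partial>lborel)"
    by (rule nn_integral_cmult) measurable
  also have "L * ennreal C * (ennreal (4 powr 2 / b) * X) = ennreal (4 powr (p + b) * C * (4 powr 2 / b)) * X" for X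
    using C b by (simp only: L_def mult.assoc[symmetric] ennreal_mult''[symmetric] powr_ge_zero divide_nonneg_pos)
  also have "ennreal (4 powr (p + b) * C * (4 powr 2 / b)) * X \<le> ennreal (C * 4 powr (p + 3) / b) * X" for X
  proof (intro mult_right_mono ennreal_leI)
    have "(4::real) powr (p + b) * 4 powr 2 \<le> 4 powr (p + 3)"
      using b unfolding powr_add[symmetric] by (intro powr_mono) auto
    then have "C / b * (4 powr (p + b) * 4 powr 2) \<le> C / b * 4 powr (p + 3)"
      using C b by (intro mult_left_mono) auto
    then show "4 powr (p + b) * C * (4 powr 2 / b) \<le> C * 4 powr (p + 3) / b" by (simp add: mult_ac)
  qed auto
  finally show ?thesis by (simp add: mult_left_mono)
qed

section \<open>Upper gradients from local Lipschitz bounds\<close>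

text \<open>
Continuous induction: the last point of \<open>{0..1}\<close> at which \<open>f\<close> is nonpositive cannot lie before \<open>1\<close>.
\<close>

lemma right_nonincreasing_imp_nonpos:
  fixes f :: "real \<Rightarrow> real"
  assumes f: "continuous_on {0..1} f" and f0: "f 0 \<le> 0"
    and right: "\<And>t. 0 \<le> t \<Longrightarrow> t < 1 \<Longrightarrow> eventually (\<lambda>s. f s \<le> f t) (at_right t)"
  shows "f 1 \<le> 0"
proof -
  define S where "S = {t \<in> {0..1}. f t \<le> 0}"
  have "S = {0..1} \<inter> f -` {..0}" by (auto simp: S_def)
  then have "closed S" using continuous_closed_preimage[OF f closed_atLeastAtMost closed_atMost] by simp
  have "0 \<in> S" using f0 by (simp add: S_def)
  moreover have "bdd_above S" by (rule bdd_aboveI[of _ 1]) (simp add: S_def)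
  ultimately have S: "S \<noteq> {}" "bdd_above S" by blast+
  have t: "Sup S \<in> S" by (rule closed_contains_Sup[OF S \<open>closed S\<close>])
  have "\<not> Sup S < 1"
  proof
    assume "Sup S < 1"
    then have "eventually (\<lambda>s. s \<in> {Sup S<..<1}) (at_right (Sup S))"
      by (rule eventually_at_right_real)
    moreover have "eventually (\<lambda>s. f s \<le> f (Sup S)) (at_right (Sup S))"
      using t \<open>Sup S < 1\<close> by (intro right) (auto simp: S_def)
    ultimately have "eventually (\<lambda>s. s \<in> {Sup S<..<1} \<and> f s \<le> f (Sup S)) (at_right (Sup S))"
      by (rule eventually_conj)
    then obtain s where s: "Sup S < s" "f s \<le> f (Sup S)" "s < 1"
      using eventually_happens[of _ "at_right (Sup S)"] by auto
    then have "s \<in> S" using t by (auto simp: S_def)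
    then show False using s S by (meson cSup_upper not_less)
  qed
  then have "Sup S = 1" using t by (auto simp: S_def)
  then show ?thesis using t by (simp add: S_def)
qed

text \<open>
A mean value theorem for functions that need not be differentiable. Subtracting the primitive of \<open>h\<close>
and a small linear function makes the one-sided upper derivative negative everywhere.
\<close>

lemma dini_bound:
  fixes \<phi> h :: "real \<Rightarrow> real"
  assumes \<phi>: "continuous_on {0..1} \<phi>" and h: "continuous_on {0..1} h"
    and right: "\<And>t \<epsilon>. 0 \<le> t \<Longrightarrow> t < 1 \<Longrightarrow> 0 < \<epsilon> \<Longrightarrow> eventually (\<lambda>s. \<phi> s - \<phi> t \<le> (h t + \<epsilon>) * (s - t)) (at_right t)"
  shows "\<phi> 1 - \<phi> 0 \<le> integral {0..1} h"
proof (rule field_le_epsilon)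
  fix e :: real assume e: "0 < e"
  define H where "H = (\<lambda>t. integral {0..t} h)"
  have "(\<phi> 1 - \<phi> 0 - H 1 - e * 1) \<le> 0"
  proof (rule right_nonincreasing_imp_nonpos[where f = "\<lambda>t. \<phi> t - \<phi> 0 - H t - e * t"])
    have "continuous_on {0..1} H"
      unfolding H_def using h by (intro indefinite_integral_continuous_1 integrable_continuous_interval)
    then show "continuous_on {0..1} (\<lambda>t. \<phi> t - \<phi> 0 - H t - e * t)" by (intro continuous_intros \<phi>)
    show "\<phi> 0 - \<phi> 0 - H 0 - e * 0 \<le> 0" by (simp add: H_def)
    fix t :: real assume t: "0 \<le> t" "t < 1"
    have "(H has_real_derivative h t) (at t within {0..1})"
      unfolding H_def using t by (intro integral_has_real_derivative h) auto
    then have "(H has_real_derivative h t) (at t within {t..1})"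
      by (rule DERIV_subset) (use t in auto)
    then have "((\<lambda>s. (H s - H t) / (s - t)) \<longlongrightarrow> h t) (at_right t)"
      using t by (simp add: has_field_derivative_iff at_within_Icc_at_right)
    then have "eventually (\<lambda>s. h t - e / 2 < (H s - H t) / (s - t)) (at_right t)"
      using e by (intro order_tendstoD) auto
    moreover have "eventually (\<lambda>s. \<phi> s - \<phi> t \<le> (h t + e / 2) * (s - t)) (at_right t)"
      using e t by (intro right) auto
    ultimately show "eventually (\<lambda>s. \<phi> s - \<phi> 0 - H s - e * s \<le> \<phi> t - \<phi> 0 - H t - e * t) (at_right t)"
      using eventually_at_right_less[of t]
    proof eventually_elim
      case (elim s)
      define P q where "P = h t * (s - t)" and "q = e / 2 * (s - t)"
      have "P - q \<le> H s - H t"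
        using elim by (simp add: P_def q_def pos_less_divide_eq less_imp_le left_diff_distrib)
      moreover have "\<phi> s - \<phi> t \<le> P + q"
        using elim(2) by (simp add: P_def q_def distrib_right)
      moreover have "e * s = e * t + q + q" by (simp add: q_def algebra_simps)
      ultimately show ?case by linarith
    qed
  qed
  then show "\<phi> 1 - \<phi> 0 \<le> integral {0..1} h + e" by (simp add: H_def)
qed

text \<open>
The bound on increments is obtained by restricting \<open>w\<close> and \<open>- w\<close> to the segment from \<open>x\<close> to \<open>y\<close>.
\<close>

lemma upper_gradientI_local:
  fixes w g :: "'a::euclidean_space \<Rightarrow> real"
  assumes w: "continuous_on UNIV w" and g: "continuous_on UNIV g" "\<And>x. 0 \<le> g x"
    and loc: "\<And>x \<epsilon>. 0 < \<epsilon> \<Longrightarrow> eventually (\<lambda>y. \<bar>w y - w x\<bar> \<le> (g x + \<epsilon>) * norm (y - x)) (at x)"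
  shows "upper_gradient w g"
  unfolding upper_gradient_def
proof (intro conjI allI w g)
  fix x y :: 'a
  show "\<bar>w y - w x\<bar> \<le> norm (y - x) * integral {0..1} (\<lambda>t. g (x + t *\<^sub>R (y - x)))"
  proof (cases "x = y")
    case False
    define \<gamma> where "\<gamma> = (\<lambda>t::real. x + t *\<^sub>R (y - x))"
    have n: "0 < norm (y - x)" using False by simp
    have \<gamma>: "continuous_on A \<gamma>" for A unfolding \<gamma>_def by (intro continuous_intros)
    have \<phi>: "continuous_on {0..1} (\<lambda>t. w (\<gamma> t))" and h: "continuous_on {0..1} (\<lambda>t. norm (y - x) * g (\<gamma> t))"
      using continuous_on_compose2[OF w \<gamma>] continuous_on_compose2[OF g(1) \<gamma>]
      by (auto intro: continuous_on_mult_left)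
    have ev: "eventually (\<lambda>s. \<bar>w (\<gamma> s) - w (\<gamma> t)\<bar> \<le> (norm (y - x) * g (\<gamma> t) + \<epsilon>) * (s - t)) (at_right t)"
      if \<epsilon>: "0 < \<epsilon>" for t \<epsilon>
    proof -
      have "filterlim \<gamma> (at (\<gamma> t)) (at_right t)"
      proof (rule filterlim_atI)
        show "(\<gamma> \<longlongrightarrow> \<gamma> t) (at_right t)" unfolding \<gamma>_def by (intro tendsto_intros)
        show "eventually (\<lambda>s. \<gamma> s \<noteq> \<gamma> t) (at_right t)"
          using eventually_at_right_less[of t] by eventually_elim (use False in \<open>auto simp: \<gamma>_def\<close>)
      qed
      moreover have "eventually (\<lambda>u. \<bar>w u - w (\<gamma> t)\<bar> \<le> (g (\<gamma> t) + \<epsilon> / norm (y - x)) * norm (u - \<gamma> t)) (at (\<gamma> t))"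
        using \<epsilon> n by (intro loc) auto
      ultimately have "eventually (\<lambda>s. \<bar>w (\<gamma> s) - w (\<gamma> t)\<bar> \<le> (g (\<gamma> t) + \<epsilon> / norm (y - x)) * norm (\<gamma> s - \<gamma> t)) (at_right t)"
        by (rule eventually_compose_filterlim[rotated])
      then show ?thesis using eventually_at_right_less[of t]
      proof eventually_elim
        case (elim s)
        have "\<gamma> s - \<gamma> t = (s - t) *\<^sub>R (y - x)" by (simp add: \<gamma>_def algebra_simps)
        then have "norm (\<gamma> s - \<gamma> t) = (s - t) * norm (y - x)" using elim by simp
        moreover have "(g (\<gamma> t) + \<epsilon> / norm (y - x)) * ((s - t) * norm (y - x)) = (norm (y - x) * g (\<gamma> t) + \<epsilon>) * (s - t)"
          using n by (simp add: field_simps)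
        ultimately show ?case using elim(1) by (simp only:)
      qed
    qed
    have "w (\<gamma> 1) - w (\<gamma> 0) \<le> integral {0..1} (\<lambda>t. norm (y - x) * g (\<gamma> t))"
      by (rule dini_bound[OF \<phi> h], rule eventually_mono[OF ev]) auto
    moreover have "(- w (\<gamma> 1)) - (- w (\<gamma> 0)) \<le> integral {0..1} (\<lambda>t. norm (y - x) * g (\<gamma> t))"
      by (rule dini_bound[OF continuous_on_minus[OF \<phi>] h], rule eventually_mono[OF ev]) auto
    ultimately show ?thesis by (simp add: \<gamma>_def)
  qed simp
qed

text \<open>
The product rule for \<open>f * e powr s\<close> with a \<open>1\<close>-Lipschitz function \<open>e\<close>; it is used for the distance
to \<open>D\<close>, truncated from below so that it stays positive.
\<close>

lemma upper_gradient_mult_powr: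
  fixes f h e :: "'a::euclidean_space \<Rightarrow> real"
  assumes f: "continuous_on UNIV f" "\<And>x. 0 \<le> f x" and h: "continuous_on UNIV h" "\<And>x. 0 \<le> h x"
    and loc: "\<And>x \<epsilon>. 0 < \<epsilon> \<Longrightarrow> eventually (\<lambda>y. \<bar>f y - f x\<bar> \<le> (h x + \<epsilon>) * norm (y - x)) (at x)"
    and e: "\<And>x. 0 < e x" "\<And>x y. \<bar>e y - e x\<bar> \<le> norm (y - x)" and s: "0 < s"
  shows "upper_gradient (\<lambda>x. f x * e x powr s) (\<lambda>x. h x * e x powr s + s * f x * e x powr (s - 1))"
proof (rule upper_gradientI_local)
  have ec: "continuous_on UNIV e"
    unfolding continuous_on_iff using e(2) by (auto simp: dist_real_def dist_norm intro: le_less_trans)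
  have ep: "continuous_on UNIV (\<lambda>x. e x powr r)" for r
    using e(1) by (intro continuous_on_powr ec continuous_on_const) (metis less_irrefl)
  show "continuous_on UNIV (\<lambda>x. f x * e x powr s)" by (intro continuous_on_mult f ep)
  show "continuous_on UNIV (\<lambda>x. h x * e x powr s + s * f x * e x powr (s - 1))"
    by (intro continuous_on_mult continuous_on_add continuous_on_const f h ep)
  show "0 \<le> h x * e x powr s + s * f x * e x powr (s - 1)" for x using f h s by simp
  fix x and \<epsilon> :: real assume \<epsilon>: "0 < \<epsilon>"
  let ?g = "h x * e x powr s + s * f x * e x powr (s - 1)"
  have "((\<lambda>\<tau>. (f x + \<tau>) * (s * e x powr (s - 1) + \<tau>) + e x powr s * (h x + \<tau>)) \<longlongrightarrow>
      (f x + 0) * (s * e x powr (s - 1) + 0) + e x powr s * (h x + 0)) (at_right 0)"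
    by (intro tendsto_intros)
  then have "eventually (\<lambda>\<tau>. (f x + \<tau>) * (s * e x powr (s - 1) + \<tau>) + e x powr s * (h x + \<tau>) < ?g + \<epsilon>) (at_right 0)"
    using \<epsilon> by (intro order_tendstoD) (auto simp: algebra_simps)
  then have "eventually (\<lambda>\<tau>. 0 < \<tau> \<and> (f x + \<tau>) * (s * e x powr (s - 1) + \<tau>) + e x powr s * (h x + \<tau>) < ?g + \<epsilon>) (at_right 0)"
    using eventually_at_right_less[of "0::real"] by eventually_elim auto
  \<comment> \<open>A common tolerance for \<open>f\<close>, \<open>h\<close> and the derivative of the power that keeps the error below \<open>\<epsilon>\<close>.\<close>
  then obtain \<tau> where \<tau>: "0 < \<tau>" "(f x + \<tau>) * (s * e x powr (s - 1) + \<tau>) + e x powr s * (h x + \<tau>) < ?g + \<epsilon>"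
    using eventually_happens[of _ "at_right (0::real)"] by auto
  have ex: "isCont e x" "isCont f x"
    using ec f(1) by (auto simp: continuous_on_eq_continuous_at)
  have "((\<lambda>t. t powr s) has_real_derivative s * e x powr (s - 1)) (at (e x))"
    using e(1) by (rule has_real_derivative_powr)
  then have "((\<lambda>t. t powr s) has_derivative (\<lambda>u. u * (s * e x powr (s - 1)))) (at (e x))"
    by (simp add: has_field_derivative_def mult_commute_abs)
  then have "eventually (\<lambda>t. norm (t powr s - e x powr s - (t - e x) * (s * e x powr (s - 1))) \<le> \<tau> * norm (t - e x)) (nhds (e x))"
    using \<tau>(1) unfolding has_derivative_within_alt eventually_nhds_metric by (auto simp: dist_norm)
  moreover have "filterlim e (nhds (e x)) (at x)" using ex(1) by (simp add: isCont_def)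
  ultimately have "eventually (\<lambda>y. norm (e y powr s - e x powr s - (e y - e x) * (s * e x powr (s - 1))) \<le> \<tau> * norm (e y - e x)) (at x)"
    by (rule eventually_compose_filterlim)
  moreover have "eventually (\<lambda>y. f y < f x + \<tau>) (at x)"
    using ex(2) \<tau>(1) by (intro order_tendstoD) (auto simp: isCont_def)
  moreover have "eventually (\<lambda>y. \<bar>f y - f x\<bar> \<le> (h x + \<tau>) * norm (y - x)) (at x)" by (rule loc[OF \<tau>(1)])
  ultimately show "eventually (\<lambda>y. \<bar>f y * e y powr s - f x * e x powr s\<bar> \<le> (?g + \<epsilon>) * norm (y - x)) (at x)"
  proof eventually_elim
    case (elim y)
    let ?k = "s * e x powr (s - 1)"
    have k: "0 \<le> ?k" using s by simp
    have "\<bar>e y powr s - e x powr s\<bar> \<le> \<bar>e y powr s - e x powr s - (e y - e x) * ?k\<bar> + \<bar>(e y - e x) * ?k\<bar>" by linarith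
    also have "\<dots> \<le> \<tau> * \<bar>e y - e x\<bar> + \<bar>e y - e x\<bar> * ?k" 
    proof (rule add_mono)
      show "\<bar>(e y - e x) * ?k\<bar> \<le> \<bar>e y - e x\<bar> * ?k" using s by (simp add: abs_mult)
    qed (use elim(1) in simp)
    also have "\<dots> = (?k + \<tau>) * \<bar>e y - e x\<bar>" by (simp add: algebra_simps)
    also have "\<dots> \<le> (?k + \<tau>) * norm (y - x)" using e(2) k \<tau> by (intro mult_left_mono) auto
    finally have 1: "\<bar>e y powr s - e x powr s\<bar> \<le> (?k + \<tau>) * norm (y - x)" .
    have "f y * e y powr s - f x * e x powr s = f y * (e y powr s - e x powr s) + e x powr s * (f y - f x)"
      by (simp add: algebra_simps)
    then have "\<bar>f y * e y powr s - f x * e x powr s\<bar> \<le> f y * \<bar>e y powr s - e x powr s\<bar> + e x powr s * \<bar>f y - f x\<bar>"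
      using f(2)[of y] by (metis abs_mult abs_of_nonneg abs_triangle_ineq powr_ge_zero)
    also have "\<dots> \<le> (f x + \<tau>) * ((?k + \<tau>) * norm (y - x)) + e x powr s * ((h x + \<tau>) * norm (y - x))"
      using 1 elim f(2)[of y] by (intro add_mono mult_mono) auto
    also have "\<dots> = ((f x + \<tau>) * (?k + \<tau>) + e x powr s * (h x + \<tau>)) * norm (y - x)"
      by (simp add: algebra_simps)
    also have "\<dots> \<le> (?g + \<epsilon>) * norm (y - x)" using \<tau>(2) by (intro mult_right_mono) auto
    finally show ?case .
  qed
qed

section \<open>Hardy's inequality on the whole space\<close>

lemma ennreal_absorb_half:
  fixes X A :: ennreal
  assumes "X \<le> A + ennreal (1/2) * X" and "X < \<infinity>"
  shows "X \<le> 2 * A"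
proof (cases A)
  case (real a)
  obtain x where x: "X = ennreal x" "0 \<le> x" using assms(2) by (cases X) auto
  have "ennreal (a + 1/2 * x) = ennreal a + ennreal (1/2) * ennreal x"
    using real x by (subst ennreal_plus, simp, simp, subst ennreal_mult', simp) (rule refl)
  then have "ennreal x \<le> ennreal (a + 1/2 * x)" using assms(1) x real by simp
  then have "x \<le> a + 1/2 * x" using x real by (subst (asm) ennreal_le_iff) auto
  then have "ennreal x \<le> ennreal (2 * a)" by (intro ennreal_leI) simp
  then show ?thesis using x real by (simp add: ennreal_mult')
qed (simp add: ennreal_mult_top)

text \<open>
Apply the weighted estimate to \<open>w = f * \<delta> powr (b / p)\<close>. Since \<open>w powr p * \<delta> powr (- p - b)\<close> equals
\<open>(f / \<delta>) powr p\<close>, the left side becomes the Hardy integral \<open>X\<close> near \<open>D\<close>; on the right side, the product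
rule yields the energy of \<open>h\<close> and \<open>(b / p) powr p * X\<close>, the latter with a factor of order \<open>1 / b\<close>.
As \<open>p > 1\<close>, a small \<open>b\<close> makes the coefficient of \<open>X\<close> at most \<open>1/2\<close>, and \<open>X\<close> is finite because \<open>f\<close>
vanishes where \<open>\<delta> < \<eta>\<close>.
\<close>

theorem hardy_locally_lipschitz:
  fixes D :: "(real^'n) set"
  assumes thick: "thick l D" and l: "real CARD('n) - p < l" and p: "1 < p"
  obtains K where "0 < K"
    "\<And>f h \<eta>. continuous_on UNIV f \<Longrightarrow> (\<And>x. 0 \<le> f x) \<Longrightarrow> continuous_on UNIV h \<Longrightarrow> (\<And>x. 0 \<le> h x) \<Longrightarrow>
       (\<And>x \<epsilon>. 0 < \<epsilon> \<Longrightarrow> eventually (\<lambda>y. \<bar>f y - f x\<bar> \<le> (h x + \<epsilon>) * norm (y - x)) (at x)) \<Longrightarrow>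
       0 < \<eta> \<Longrightarrow> (\<And>x. infdist x D < \<eta> \<Longrightarrow> f x = 0 \<and> h x = 0) \<Longrightarrow> energy p f UNIV < \<infinity> \<Longrightarrow>
       (\<integral>\<^sup>+x. ennreal ((f x / infdist x D) powr p) \<partial>lborel) \<le> ennreal K * (energy p h UNIV + energy p f UNIV)"
proof -
  have p1: "1 \<le> p" using p by simp
  have D: "D \<noteq> {}" using thick by (simp add: thick_def)
  obtain R C where R: "0 < R" and C: "0 < C" and poincare:
    "\<And>w g z \<rho>. upper_gradient w g \<Longrightarrow> (\<And>y. y \<in> D \<Longrightarrow> w y = 0) \<Longrightarrow> z \<in> D \<Longrightarrow> 0 < \<rho> \<Longrightarrow> \<rho> \<le> R \<Longrightarrow>
       energy p w (ball z (2 * \<rho>)) \<le> ennreal (C * \<rho> powr p) * energy p g (ball z (2 * \<rho>))"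
    using thick_poincare[OF thick l p1] by blast
  define C' where "C' = 6 ^ CARD('n) * C * 4 powr (p + 3)"
  have C': "0 < C'" using C by (simp add: C'_def)
  \<comment> \<open>The largest exponent in \<open>(0, 1]\<close> with \<open>2 powr p * C' * b powr (p - 1) \<le> 1 / 2\<close>.\<close>
  define b where "b = min 1 ((1 / (2 * (2 powr p * C'))) powr (1 / (p - 1)))"
  have b: "0 < b" "b \<le> 1" using C' by (auto simp: b_def)
  have b_small: "C' / b * 2 powr p * b powr p \<le> 1 / 2"
  proof -
    have "b powr (p - 1) \<le> ((1 / (2 * (2 powr p * C'))) powr (1 / (p - 1))) powr (p - 1)"
      using p b by (intro powr_mono2) (auto simp: b_def)
    also have "\<dots> = 1 / (2 * (2 powr p * C'))" using p C' by (simp add: powr_powr)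
    finally have "2 powr p * C' * b powr (p - 1) \<le> 2 powr p * C' * (1 / (2 * (2 powr p * C')))"
      using C' by (intro mult_left_mono) auto
    also have "\<dots> = 1 / 2" using C' by simp
    also have "2 powr p * C' * b powr (p - 1) = C' / b * 2 powr p * b powr p"
      using b by (simp add: powr_diff)
    finally show ?thesis .
  qed
  define c where "c = C' / b * 2 powr p"
  have c: "0 < c" using C' b by (simp add: c_def)
  define K where "K = 2 * ((2 / R) powr p + c)"
  have K: "0 < K" using c by (simp add: K_def add_nonneg_pos)
  show thesis
  proof (rule that[OF K])
    fix f h :: "real^'n \<Rightarrow> real" and \<eta>
    assume f: "continuous_on UNIV f" "\<And>x. 0 \<le> f x" and h: "continuous_on UNIV h" "\<And>x. 0 \<le> h x"
      and loc: "\<And>x \<epsilon>. 0 < \<epsilon> \<Longrightarrow> eventually (\<lambda>y. \<bar>f y - f x\<bar> \<le> (h x + \<epsilon>) * norm (y - x)) (at x)"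
      and \<eta>: "0 < \<eta>" and zero: "\<And>x. infdist x D < \<eta> \<Longrightarrow> f x = 0 \<and> h x = 0" and fin: "energy p f UNIV < \<infinity>"
    define \<delta> where "\<delta> = (\<lambda>x. infdist x D)"
    \<comment> \<open>Where \<open>f\<close> or \<open>h\<close> is nonzero, \<open>e\<close> agrees with \<open>\<delta>\<close>; being positive, it can be raised to the power \<open>s - 1\<close> without a singularity.\<close>
    define e where "e = (\<lambda>x. max (\<delta> x) \<eta>)"
    define s where "s = b / p"
    define w where "w = (\<lambda>x. f x * e x powr s)"
    define g where "g = (\<lambda>x. h x * e x powr s + s * f x * e x powr (s - 1))"
    have s: "0 < s" "s \<le> b" "s * p = b" using b p by (auto simp: s_def divide_le_eq mult_le_cancel_left1)
    have \<delta>0: "0 \<le> \<delta> x" for x by (simp add: \<delta>_def infdist_nonneg)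
    have e_lip: "\<bar>e y - e x\<bar> \<le> norm (y - x)" for x y
      using infdist_triangle_abs[of y D x] by (auto simp: e_def \<delta>_def max_def dist_norm)
    have ug: "upper_gradient w g"
      unfolding w_def g_def using \<eta> s(1) by (intro upper_gradient_mult_powr f h loc e_lip) (auto simp: e_def)
    have [measurable]: "f \<in> borel_measurable borel" "h \<in> borel_measurable borel"
        "w \<in> borel_measurable borel" "g \<in> borel_measurable borel" "\<delta> \<in> borel_measurable borel"
      using f h ug unfolding upper_gradient_def \<delta>_def
      by (auto intro!: borel_measurable_continuous_onI continuous_on_infdist continuous_on_id)
    have w_eq: "\<bar>w x\<bar> powr p * \<delta> x powr (- p - b) = (f x / \<delta> x) powr p" for x
    proof (cases "\<delta> x < \<eta>")
      case True
      then show ?thesis using zero[of x] p by (simp add: w_def \<delta>_def)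
    next
      case False
      then have "e x = \<delta> x" "0 < \<delta> x" using \<eta> by (auto simp: e_def)
      then show ?thesis using f(2)[of x] s(3)
        by (simp add: w_def powr_mult powr_powr powr_divide powr_diff powr_minus_divide)
    qed
    have g_le: "\<bar>g x\<bar> powr p * \<delta> x powr (- b) \<le> 2 powr p * (h x powr p + b powr p * (f x / \<delta> x) powr p)" for x
    proof (cases "\<delta> x < \<eta>")
      case True
      then show ?thesis using zero[of x] p by (simp add: g_def \<delta>_def)
    next
      case False
      then have e: "e x = \<delta> x" and dx: "0 < \<delta> x" using \<eta> by (auto simp: e_def)
      have "\<bar>g x\<bar> powr p \<le> 2 powr p * ((h x * \<delta> x powr s) powr p + (s * f x * \<delta> x powr (s - 1)) powr p)"
        unfolding g_def e using powr_add_le[of "h x * \<delta> x powr s" "s * f x * \<delta> x powr (s - 1)" p] h(2)[of x] f(2)[of x] s(1) p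
        by simp
      also have "(h x * \<delta> x powr s) powr p = h x powr p * \<delta> x powr b"
        using s(3) by (simp add: powr_mult powr_powr)
      also have "(s * f x * \<delta> x powr (s - 1)) powr p = s powr p * (f x / \<delta> x) powr p * \<delta> x powr b"
      proof -
        have "(\<delta> x powr (s - 1)) powr p = \<delta> x powr b / \<delta> x powr p"
          by (simp only: powr_powr left_diff_distrib s(3) mult_1 powr_diff[of _ b])
        then show ?thesis by (simp only: powr_mult powr_divide) simp
      qed
      also have "s powr p * (f x / \<delta> x) powr p * \<delta> x powr b \<le> b powr p * (f x / \<delta> x) powr p * \<delta> x powr b"
        using s p by (intro mult_right_mono powr_mono2) auto
      finally have "\<bar>g x\<bar> powr p \<le> 2 powr p * (h x powr p + b powr p * (f x / \<delta> x) powr p) * \<delta> x powr b"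
        by (simp add: algebra_simps)
      then have "\<bar>g x\<bar> powr p * \<delta> x powr (- b) \<le> 2 powr p * (h x powr p + b powr p * (f x / \<delta> x) powr p) * \<delta> x powr b * \<delta> x powr (- b)"
        by (rule mult_right_mono) simp
      also have "\<dots> = 2 powr p * (h x powr p + b powr p * (f x / \<delta> x) powr p) * (\<delta> x powr b * \<delta> x powr (- b))"
        by (simp only: mult.assoc)
      also have "\<delta> x powr b * \<delta> x powr (- b) = 1" using dx by (simp add: powr_add[symmetric])
      finally show ?thesis by simp
    qed
    define X where "X = (\<integral>\<^sup>+x. ennreal ((f x / \<delta> x) powr p) \<partial>lborel)"
    have eh: "energy p h UNIV = (\<integral>\<^sup>+x. ennreal (h x powr p) \<partial>lborel)"
      and ef: "energy p f UNIV = (\<integral>\<^sup>+x. ennreal (f x powr p) \<partial>lborel)"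
      using f h by (simp_all add: energy_def)
    have Xfin: "X < \<infinity>"
    proof -
      have "(f x / \<delta> x) powr p \<le> (1 / \<eta>) powr p * f x powr p" for x
      proof (cases "\<delta> x < \<eta>")
        case True then show ?thesis using zero[of x] p by (simp add: \<delta>_def)
      next
        case False
        then have "f x / \<delta> x \<le> 1 / \<eta> * f x" using \<eta> f(2)[of x] by (simp add: frac_le)
        then show ?thesis unfolding powr_mult[symmetric] using f(2)[of x] \<delta>0[of x] p by (intro powr_mono2) auto
      qed
      then have "X \<le> (\<integral>\<^sup>+x. ennreal ((1 / \<eta>) powr p) * ennreal (f x powr p) \<partial>lborel)"
        unfolding X_def by (intro nn_integral_mono) (simp add: ennreal_mult'[symmetric] ennreal_leI)
      also have "\<dots> = ennreal ((1 / \<eta>) powr p) * energy p f UNIV"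
        unfolding ef by (rule nn_integral_cmult) measurable
      also have "\<dots> < \<infinity>" using fin by (simp add: ennreal_mult_less_top)
      finally show ?thesis .
    qed
    have est: "energy p w {x. \<delta> x < \<rho> / 2} \<le> ennreal (6 ^ CARD('n) * C * \<rho> powr p) * energy p g {x. \<delta> x < 4 * \<rho>}"
      if \<rho>: "0 < \<rho>" "\<rho> \<le> R" for \<rho>
    proof -
      have "w y = 0" if "y \<in> D" for y using zero[of y] that \<eta> by (simp add: w_def)
      then have "energy p w {x. infdist x D < \<rho> / 2} \<le> ennreal (6 ^ DIM(real^'n) * (C * \<rho> powr p)) * energy p g {x. infdist x D < 4 * \<rho>}"
        using C \<rho> by (intro neighbourhood_estimate poincare ug D) auto
      then show ?thesis by (simp add: \<delta>_def mult.assoc)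
    qed
    have near: "(\<integral>\<^sup>+x. ennreal ((f x / \<delta> x) powr p) * indicator {x. \<delta> x < R / 2} x \<partial>lborel)
        \<le> ennreal (C' / b) * (\<integral>\<^sup>+x. ennreal (\<bar>g x\<bar> powr p * \<delta> x powr (- b)) \<partial>lborel)"
    proof -
      have g0: "g x = 0" if "\<delta> x = 0" for x using zero[of x] that \<eta> by (simp add: g_def \<delta>_def)
      have "(\<integral>\<^sup>+x. ennreal (\<bar>w x\<bar> powr p * \<delta> x powr (- p - b)) * indicator {x. \<delta> x < R / 2} x \<partial>lborel)
        \<le> ennreal (6 ^ CARD('n) * C * 4 powr (p + 3) / b) * (\<integral>\<^sup>+x. ennreal (\<bar>g x\<bar> powr p * \<delta> x powr (- b)) \<partial>lborel)"
        using C by (intro weighted_estimate \<delta>0 g0 R p1 b est) auto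
      then show ?thesis unfolding w_eq C'_def .
    qed
    have "(\<integral>\<^sup>+x. ennreal (\<bar>g x\<bar> powr p * \<delta> x powr (- b)) \<partial>lborel)
        \<le> (\<integral>\<^sup>+x. ennreal (2 powr p) * (ennreal (h x powr p) + ennreal (b powr p) * ennreal ((f x / \<delta> x) powr p)) \<partial>lborel)"
    proof (rule nn_integral_mono)
      fix x
      have "ennreal (\<bar>g x\<bar> powr p * \<delta> x powr (- b)) \<le> ennreal (2 powr p * (h x powr p + b powr p * (f x / \<delta> x) powr p))"
        by (intro ennreal_leI g_le)
      also have "\<dots> = ennreal (2 powr p) * (ennreal (h x powr p) + ennreal (b powr p) * ennreal ((f x / \<delta> x) powr p))"
        by (simp add: ennreal_mult')
      finally show "ennreal (\<bar>g x\<bar> powr p * \<delta> x powr (- b)) \<le> ennreal (2 powr p) * (ennreal (h x powr p) + ennreal (b powr p) * ennreal ((f x / \<delta> x) powr p))" .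
    qed
    also have "\<dots> = ennreal (2 powr p) * (energy p h UNIV + ennreal (b powr p) * X)"
      unfolding eh X_def
      by (subst nn_integral_cmult, measurable, subst nn_integral_add, measurable, subst nn_integral_cmult, measurable)
    finally have "(\<integral>\<^sup>+x. ennreal ((f x / \<delta> x) powr p) * indicator {x. \<delta> x < R / 2} x \<partial>lborel)
        \<le> ennreal (C' / b) * (ennreal (2 powr p) * (energy p h UNIV + ennreal (b powr p) * X))"
      by (rule order_trans[OF near mult_left_mono]) simp
    also have "\<dots> = ennreal c * energy p h UNIV + ennreal (c * b powr p) * X"
    proof -
      have "ennreal c = ennreal (C' / b) * ennreal (2 powr p)" unfolding c_def by (rule ennreal_mult'') simp
      moreover have "ennreal (c * b powr p) = ennreal c * ennreal (b powr p)" by (rule ennreal_mult'') simp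
      ultimately show ?thesis by (simp only: distrib_left mult.assoc)
    qed
    also have "\<dots> \<le> ennreal c * energy p h UNIV + ennreal (1/2) * X"
      using b_small by (intro add_left_mono mult_right_mono ennreal_leI) (auto simp: c_def)
    finally have X1: "(\<integral>\<^sup>+x. ennreal ((f x / \<delta> x) powr p) * indicator {x. \<delta> x < R / 2} x \<partial>lborel)
        \<le> ennreal c * energy p h UNIV + ennreal (1/2) * X" .
    have "X \<le> (\<integral>\<^sup>+x. ennreal ((f x / \<delta> x) powr p) * indicator {x. \<delta> x < R / 2} x
        + ennreal ((2 / R) powr p) * ennreal (f x powr p) \<partial>lborel)"
      unfolding X_def
    proof (rule nn_integral_mono)
      fix x
      show "ennreal ((f x / \<delta> x) powr p) \<le> ennreal ((f x / \<delta> x) powr p) * indicator {x. \<delta> x < R / 2} x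
        + ennreal ((2 / R) powr p) * ennreal (f x powr p)"
      proof (cases "\<delta> x < R / 2")
        case False
        then have "f x / \<delta> x \<le> 2 / R * f x" using R f(2)[of x] frac_le[of "f x" "f x" "R / 2" "\<delta> x"] by (simp add: mult.commute)
        then have "(f x / \<delta> x) powr p \<le> (2 / R) powr p * f x powr p"
          unfolding powr_mult[symmetric] using f(2)[of x] \<delta>0[of x] p by (intro powr_mono2) auto
        then show ?thesis using False by (simp add: ennreal_mult'[symmetric] ennreal_leI)
      qed simp
    qed
    also have "\<dots> = (\<integral>\<^sup>+x. ennreal ((f x / \<delta> x) powr p) * indicator {x. \<delta> x < R / 2} x \<partial>lborel)
        + ennreal ((2 / R) powr p) * energy p f UNIV"
      unfolding ef by (subst nn_integral_add, measurable, subst nn_integral_cmult, measurable)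
    also have "\<dots> \<le> (ennreal c * energy p h UNIV + ennreal (1/2) * X) + ennreal ((2 / R) powr p) * energy p f UNIV"
      by (intro add_right_mono X1)
    finally have "X \<le> (ennreal c * energy p h UNIV + ennreal ((2 / R) powr p) * energy p f UNIV) + ennreal (1/2) * X"
      by (simp add: ac_simps)
    then have "X \<le> 2 * (ennreal c * energy p h UNIV + ennreal ((2 / R) powr p) * energy p f UNIV)"
      using Xfin by (rule ennreal_absorb_half)
    also have "\<dots> \<le> 2 * (ennreal ((2 / R) powr p + c) * energy p h UNIV + ennreal ((2 / R) powr p + c) * energy p f UNIV)"
      using c by (intro mult_left_mono add_mono mult_right_mono ennreal_leI) auto
    also have "\<dots> = ennreal K * (energy p h UNIV + energy p f UNIV)"
    proof -
      have "ennreal K = 2 * ennreal ((2 / R) powr p + c)"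
        unfolding K_def by (subst ennreal_mult') auto
      then show ?thesis by (simp add: distrib_left mult.assoc)
    qed
    finally show "(\<integral>\<^sup>+x. ennreal ((f x / infdist x D) powr p) \<partial>lborel) \<le> ennreal K * (energy p h UNIV + energy p f UNIV)"
      by (simp add: X_def \<delta>_def)
  qed
qed

lemma norm_frechet_derivative_le_grad:
  fixes v :: "real^'n \<Rightarrow> 'k::{real_normed_field,euclidean_space}"
  assumes "v differentiable (at x)"
  shows "norm (frechet_derivative v (at x) z) \<le> norm (grad v x) * norm z"
proof -
  let ?D = "frechet_derivative v (at x)"
  have lin: "linear ?D" by (rule linear_frechet_derivative[OF assms])
  have "z = (\<Sum>i\<in>UNIV. z $ i *\<^sub>R axis i 1)"
    using basis_expansion[of z] by (simp add: scalar_mult_eq_scaleR)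
  then have "?D z = ?D (\<Sum>i\<in>UNIV. z $ i *\<^sub>R axis i 1)" by (rule arg_cong)
  also have "\<dots> = (\<Sum>i\<in>UNIV. z $ i *\<^sub>R ?D (axis i 1))"
    by (simp add: linear_sum[OF lin] linear_scale[OF lin])
  finally have "norm (?D z) \<le> (\<Sum>i\<in>UNIV. norm (z $ i *\<^sub>R ?D (axis i 1)))"
    by (simp only: norm_sum)
  also have "\<dots> = (\<Sum>i\<in>UNIV. \<bar>z $ i\<bar> * norm (?D (axis i 1)))" by simp
  also have "\<dots> = (\<Sum>i\<in>UNIV. \<bar>z $ i\<bar> * \<bar>norm (grad v x $ i)\<bar>)"
    by (simp add: grad_def partial_deriv_def)
  also have "\<dots> \<le> L2_set (($) z) UNIV * L2_set (\<lambda>i. norm (grad v x $ i)) UNIV"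
    by (rule L2_set_mult_ineq)
  also have "\<dots> = norm (grad v x) * norm z"
    by (simp add: norm_vec_def L2_set_def mult.commute)
  finally show ?thesis .
qed

lemma test_function_C1:
  assumes "v \<in> test_functions E"
  shows "continuous_on UNIV v" "continuous_on UNIV (grad v)" "\<And>x. v differentiable (at x)"
proof -
  have C: "Ck k v" for k using assms by (simp add: test_functions_def)
  show "continuous_on UNIV v" using C[of 0] by simp
  show "\<And>x. v differentiable (at x)" using C[of 1] by simp
  have "continuous_on UNIV (partial_deriv i v)" for i using C[of "Suc 0"] by simp
  then show "continuous_on UNIV (grad v)"
    unfolding grad_def by (intro continuous_on_vec_lambda)
qed

lemma test_function_lipschitz_at:
  fixes v :: "real^'n \<Rightarrow> 'k::{real_normed_field,euclidean_space}"
  assumes "v differentiable (at x)" and \<epsilon>: "0 < \<epsilon>"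
  shows "eventually (\<lambda>y. \<bar>norm (v y) - norm (v x)\<bar> \<le> (norm (grad v x) + \<epsilon>) * norm (y - x)) (at x)"
proof -
  let ?D = "frechet_derivative v (at x)"
  have "(v has_derivative ?D) (at x)" using assms frechet_derivative_works by blast
  then obtain d where "0 < d" "\<And>y. norm (y - x) < d \<Longrightarrow> norm (v y - v x - ?D (y - x)) \<le> \<epsilon> * norm (y - x)"
    using \<epsilon> unfolding has_derivative_within_alt by auto
  then have "eventually (\<lambda>y. norm (v y - v x - ?D (y - x)) \<le> \<epsilon> * norm (y - x)) (at x)"
    unfolding eventually_at by (intro exI[of _ d]) (auto simp: dist_norm)
  then show ?thesis
  proof eventually_elim
    case (elim y)
    have "\<bar>norm (v y) - norm (v x)\<bar> \<le> norm (v y - v x)" by (rule norm_triangle_ineq3)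
    also have "\<dots> \<le> norm (v y - v x - ?D (y - x)) + norm (?D (y - x))"
      by (rule norm_triangle_sub[of "v y - v x" "?D (y - x)", unfolded add.commute[of "norm (?D (y - x))"]])
    also have "\<dots> \<le> \<epsilon> * norm (y - x) + norm (grad v x) * norm (y - x)"
      by (intro add_mono elim norm_frechet_derivative_le_grad assms)
    finally show ?case by (simp add: algebra_simps)
  qed
qed

text \<open>
The support is compact and disjoint from the closed set \<open>D\<close>, hence at positive distance from it.
\<close>

lemma test_function_zero_near:
  fixes v :: "real^'n \<Rightarrow> 'k::{real_normed_field,euclidean_space}"
  assumes v: "v \<in> test_functions D" and D: "closed D" "D \<noteq> {}"
  obtains \<eta> where "0 < \<eta>" "\<And>x. infdist x D < \<eta> \<Longrightarrow> v x = 0 \<and> grad v x = 0"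
proof -
  have supp: "compact (supp v)" "supp v \<inter> D = {}" using v by (auto simp: test_functions_def)
  obtain \<eta> where \<eta>: "0 < \<eta>" "\<And>x y. x \<in> supp v \<Longrightarrow> y \<in> D \<Longrightarrow> \<eta> \<le> dist x y"
    using separate_compact_closed[OF supp(1) D(1) supp(2)] by auto
  have v0: "v x = 0" if "infdist x D < \<eta>" for x
  proof (rule ccontr)
    assume "v x \<noteq> 0"
    then have "x \<in> supp v" unfolding supp_def by (intro subsetD[OF closure_subset]) auto
    then have "\<eta> \<le> infdist x D" unfolding infdist_def using D \<eta> by (auto intro: cINF_greatest)
    then show False using that by simp
  qed
  have "grad v x = 0" if x: "infdist x D < \<eta>" for x
  proof -
    have "open {y. infdist y D < \<eta>}" by (intro open_Collect_less continuous_intros)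
    then have "(v has_derivative (\<lambda>_. 0)) (at x)"
      by (rule has_derivative_transform_within_open[OF has_derivative_const[of 0]]) (use x v0 in auto)
    then have "frechet_derivative v (at x) = (\<lambda>_. 0)" by (rule frechet_derivative_at[symmetric])
    then show ?thesis by (simp add: grad_def partial_deriv_def vec_eq_iff)
  qed
  then show thesis using that \<eta>(1) v0 by blast
qed

lemma test_function_energy_finite:
  fixes v :: "real^'n \<Rightarrow> 'k::{real_normed_field,euclidean_space}"
  assumes v: "v \<in> test_functions E" and p: "0 < p"
  shows "energy p (\<lambda>x. norm (v x)) UNIV < \<infinity>" "energy p (\<lambda>x. norm (grad v x)) UNIV < \<infinity>"
proof -
  have bd: "bounded (supp v)" using v by (auto simp: test_functions_def compact_imp_bounded)
  have v0: "v x = 0" if "x \<notin> supp v" for x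
    using that unfolding supp_def by (meson closure_subset mem_Collect_eq subsetD)
  have g0: "grad v x = 0" if "x \<notin> supp v" for x
  proof -
    have "open (- supp v)" by (simp add: supp_def open_Compl)
    then have "(v has_derivative (\<lambda>_. 0)) (at x)"
      by (rule has_derivative_transform_within_open[OF has_derivative_const[of 0]]) (use that v0 in auto)
    then have "frechet_derivative v (at x) = (\<lambda>_. 0)" by (rule frechet_derivative_at[symmetric])
    then show ?thesis by (simp add: grad_def partial_deriv_def vec_eq_iff)
  qed
  have fin: "energy p f UNIV < \<infinity>" if f: "continuous_on UNIV f" "\<And>x. x \<notin> supp v \<Longrightarrow> f x = 0" for f :: "real^'n \<Rightarrow> real"
  proof -
    have "energy p f UNIV = energy p f (supp v)"
      unfolding energy_def using f p by (intro nn_integral_cong) (auto simp: indicator_def)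
    then show ?thesis using energy_finite[OF f(1) bd p] by simp
  qed
  show "energy p (\<lambda>x. norm (v x)) UNIV < \<infinity>"
    by (rule fin[OF continuous_on_norm]) (simp_all add: test_function_C1[OF v] v0)
  show "energy p (\<lambda>x. norm (grad v x)) UNIV < \<infinity>"
    by (rule fin[OF continuous_on_norm]) (simp_all add: test_function_C1[OF v] g0)
qed

theorem hardy_test_functions:
  fixes D :: "(real^'n) set"
  assumes thick: "thick l D" and l: "real CARD('n) - p < l" and p: "1 < p"
  obtains K where "0 < K"
    "\<And>v :: real^'n \<Rightarrow> 'k::{real_normed_field,euclidean_space}. v \<in> test_functions D \<Longrightarrow>
      (\<integral>\<^sup>+x. ennreal ((norm (v x) / infdist x D) powr p) \<partial>lborel)
        \<le> ennreal K * (energy p (\<lambda>x. norm (grad v x)) UNIV + energy p (\<lambda>x. norm (v x)) UNIV)"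
proof -
  have D: "closed D" "D \<noteq> {}" using thick by (auto simp: thick_def compact_imp_closed)
  obtain K where K: "0 < K" and hardy:
    "\<And>f h \<eta>. continuous_on UNIV f \<Longrightarrow> (\<And>x. 0 \<le> f x) \<Longrightarrow> continuous_on UNIV h \<Longrightarrow> (\<And>x. 0 \<le> h x) \<Longrightarrow>
       (\<And>x \<epsilon>. 0 < \<epsilon> \<Longrightarrow> eventually (\<lambda>y. \<bar>f y - f x\<bar> \<le> (h x + \<epsilon>) * norm (y - x)) (at x)) \<Longrightarrow>
       0 < \<eta> \<Longrightarrow> (\<And>x. infdist x D < \<eta> \<Longrightarrow> f x = 0 \<and> h x = 0) \<Longrightarrow> energy p f UNIV < \<infinity> \<Longrightarrow>
       (\<integral>\<^sup>+x. ennreal ((f x / infdist x D) powr p) \<partial>lborel) \<le> ennreal K * (energy p h UNIV + energy p f UNIV)"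
    using hardy_locally_lipschitz[OF thick l p] by blast
  show thesis
  proof (rule that[OF K])
    fix v :: "real^'n \<Rightarrow> 'k" assume v: "v \<in> test_functions D"
    obtain \<eta> where \<eta>: "0 < \<eta>" "\<And>x. infdist x D < \<eta> \<Longrightarrow> v x = 0 \<and> grad v x = 0"
      using test_function_zero_near[OF v D] by blast
    show "(\<integral>\<^sup>+x. ennreal ((norm (v x) / infdist x D) powr p) \<partial>lborel)
        \<le> ennreal K * (energy p (\<lambda>x. norm (grad v x)) UNIV + energy p (\<lambda>x. norm (v x)) UNIV)"
    proof (rule hardy[OF _ _ _ _ _ \<eta>(1)])
      show "energy p (\<lambda>x. norm (v x)) UNIV < \<infinity>" using test_function_energy_finite(1)[OF v] p by simp
      show "eventually (\<lambda>y. \<bar>norm (v y) - norm (v x)\<bar> \<le> (norm (grad v x) + \<epsilon>) * norm (y - x)) (at x)"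
        if "0 < \<epsilon>" for x and \<epsilon> :: real
        using test_function_C1(3)[OF v] that by (rule test_function_lipschitz_at)
      show "continuous_on UNIV (\<lambda>x. norm (v x))" "continuous_on UNIV (\<lambda>x. norm (grad v x))"
        by (intro continuous_on_norm test_function_C1[OF v])+
    qed (use \<eta>(2) in auto)
  qed
qed

section \<open>Passage to Sobolev functions\<close>

lemma nonneg_powr_tendsto_zeroD:
  fixes f :: "nat \<Rightarrow> real"
  assumes "(\<lambda>n. f n powr a) \<longlonglongrightarrow> 0" and "0 < a" and "\<And>n. 0 \<le> f n"
  shows "f \<longlonglongrightarrow> 0"
proof -
  have "(\<lambda>n. (f n powr a) powr (1 / a)) \<longlonglongrightarrow> 0 powr (1 / a)"
    using assms by (intro tendsto_powr' tendsto_const) auto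
  then show ?thesis using assms by (simp add: powr_powr)
qed

lemma in_Lp_diff:
  fixes f g :: "real^'n \<Rightarrow> 'b::euclidean_space"
  assumes f: "in_Lp p \<Lambda> f" and g: "in_Lp p \<Lambda> g" and p: "0 \<le> p"
  shows "in_Lp p \<Lambda> (\<lambda>x. f x - g x)"
  unfolding in_Lp_def
proof
  have [measurable]: "f \<in> borel_measurable (lebesgue_on \<Lambda>)" "g \<in> borel_measurable (lebesgue_on \<Lambda>)"
    using f g by (auto simp: in_Lp_def)
  show "(\<lambda>x. f x - g x) \<in> borel_measurable (lebesgue_on \<Lambda>)" by measurable
  show "integrable (lebesgue_on \<Lambda>) (\<lambda>x. norm (f x - g x) powr p)"
  proof (rule Bochner_Integration.integrable_bound)
    show "integrable (lebesgue_on \<Lambda>) (\<lambda>x. 2 powr p * (norm (f x) powr p + norm (g x) powr p))"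
      using f g by (intro integrable_mult_right Bochner_Integration.integrable_add) (auto simp: in_Lp_def)
    have "norm (f x - g x) powr p \<le> 2 powr p * (norm (f x) powr p + norm (g x) powr p)" for x
      by (rule order_trans[OF powr_mono2[OF p _ norm_triangle_ineq4] powr_add_le]) (use p in auto)
    then show "AE x in lebesgue_on \<Lambda>. norm (norm (f x - g x) powr p)
        \<le> norm (2 powr p * (norm (f x) powr p + norm (g x) powr p))"
      by (intro AE_I2) simp
  qed measurable
qed

lemma test_function_in_Lp:
  fixes v :: "real^'n \<Rightarrow> 'k::{real_normed_field,euclidean_space}"
  assumes v: "v \<in> test_functions E" and p: "0 < p"
  shows "in_Lp p UNIV v" "in_Lp p UNIV (grad v)"
proof -
  have Lp: "in_Lp p UNIV f"
    if f: "continuous_on UNIV f" and fin: "energy p (\<lambda>x. norm (f x)) UNIV < \<infinity>" for f :: "real^'n \<Rightarrow> 'b::euclidean_space"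
  proof -
    have [measurable]: "f \<in> borel_measurable borel" using f by (rule borel_measurable_continuous_onI)
    have "integrable lborel (\<lambda>x. norm (f x) powr p)"
      using fin by (intro integrableI_nonneg) (auto simp: energy_def)
    then have "integrable lebesgue (\<lambda>x. norm (f x) powr p)"
      by (simp add: integrable_completion)
    moreover have "f \<in> borel_measurable lebesgue" by (intro measurable_completion) simp
    ultimately show ?thesis by (simp add: in_Lp_def lebesgue_on_UNIV_eq)
  qed
  show "in_Lp p UNIV v" "in_Lp p UNIV (grad v)"
    using test_function_energy_finite[OF v p] test_function_C1[OF v] by (auto intro: Lp)
qed

text \<open>
The functions \<open>q n\<close>, whose integrals are the \<open>p\<close>-th powers of the Sobolev distances, tend to \<open>0\<close> in
\<open>L^1\<close>. Along a subsequence they tend to \<open>0\<close> almost everywhere, and so the test functions converge to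
\<open>U\<close> almost everywhere. Fatou's lemma transports Hardy's inequality to the limit.
\<close>

theorem hardy_W1p_whole_space:
  fixes D :: "(real^'n) set"
  assumes thick: "thick l D" and l: "real CARD('n) - p < l" and p: "1 < p"
  obtains K where "0 < K"
    "\<And>(U :: real^'n \<Rightarrow> 'k::{real_normed_field,euclidean_space}) H. W1p D UNIV p U H \<Longrightarrow>
      (\<integral>\<^sup>+x. ennreal ((norm (U x) / infdist x D) powr p) \<partial>lebesgue) \<le> ennreal (K * W1p_norm p UNIV U H powr p)"
proof -
  obtain K where K: "0 < K" and hardy:
    "\<And>v :: real^'n \<Rightarrow> 'k. v \<in> test_functions D \<Longrightarrow>
      (\<integral>\<^sup>+x. ennreal ((norm (v x) / infdist x D) powr p) \<partial>lborel)
        \<le> ennreal K * (energy p (\<lambda>x. norm (grad v x)) UNIV + energy p (\<lambda>x. norm (v x)) UNIV)"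
    using hardy_test_functions[OF thick l p] by blast
  have p0: "0 < p" "0 \<le> p" using p by auto
  define K2 where "K2 = K * 2 powr p"
  have K2: "0 < K2" using K by (simp add: K2_def)
  show thesis
  proof (rule that[OF K2])
    fix U :: "real^'n \<Rightarrow> 'k" and H assume W: "W1p D UNIV p U H"
    obtain v where v: "\<And>n::nat. v n \<in> test_functions D"
      and lim: "(\<lambda>n. W1p_norm p UNIV (\<lambda>x. v n x - U x) (\<lambda>x. grad (v n) x - H x)) \<longlonglongrightarrow> 0"
      and Lp: "in_Lp p UNIV U" "in_Lp p UNIV H"
      using W by (auto simp: W1p_def)
    define q where "q = (\<lambda>n x. norm (grad (v n) x - H x) powr p + norm (v n x - U x) powr p)"
    define N where "N = (\<lambda>x. norm (H x) powr p + norm (U x) powr p)"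
    have Nint: "integrable lebesgue N"
      using Lp unfolding N_def by (intro Bochner_Integration.integrable_add) (auto simp: in_Lp_def lebesgue_on_UNIV_eq)
    have qint: "integrable lebesgue (q n)" for n
      using in_Lp_diff[OF test_function_in_Lp(1)[OF v p0(1)] Lp(1) p0(2)]
        in_Lp_diff[OF test_function_in_Lp(2)[OF v p0(1)] Lp(2) p0(2)]
      unfolding q_def by (intro Bochner_Integration.integrable_add) (auto simp: in_Lp_def lebesgue_on_UNIV_eq)
    have q0: "0 \<le> q n x" and N0: "0 \<le> N x" for n x by (simp_all add: q_def N_def)
    define e where "e = (\<lambda>n. integral\<^sup>L lebesgue (q n))"
    have e0: "0 \<le> e n" for n by (simp add: e_def q0)
    have e: "e \<longlonglongrightarrow> 0"
    proof (rule nonneg_powr_tendsto_zeroD)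
      show "(\<lambda>n. e n powr (1 / p)) \<longlonglongrightarrow> 0"
        using lim by (simp add: W1p_norm_def e_def q_def lebesgue_on_UNIV_eq)
    qed (use p e0 in auto)
    have normU: "W1p_norm p UNIV U H powr p = integral\<^sup>L lebesgue N"
      using p by (simp add: W1p_norm_def N_def lebesgue_on_UNIV_eq powr_powr)
    have "(\<lambda>n. integral\<^sup>L lebesgue (\<lambda>x. norm (q n x))) \<longlonglongrightarrow> 0"
      using e q0 by (simp add: e_def)
    then obtain r where r: "strict_mono r" and ae: "AE x in lebesgue. (\<lambda>n. q (r n) x) \<longlonglongrightarrow> 0"
      using tendsto_L1_AE_subseq[of lebesgue q] qint by blast
    define f where "f = (\<lambda>n x. ennreal ((norm (v (r n) x) / infdist x D) powr p))"
    have f_bound: "(\<integral>\<^sup>+x. f n x \<partial>lebesgue) \<le> ennreal (K2 * (e (r n) + integral\<^sup>L lebesgue N))" for n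
    proof -
      let ?v = "v (r n)"
      have [measurable]: "?v \<in> borel_measurable borel" "grad ?v \<in> borel_measurable borel"
        using test_function_C1[OF v] by (auto intro: borel_measurable_continuous_onI)
      have split: "a powr p \<le> 2 powr p * (b powr p + c powr p)" if "0 \<le> a" "a \<le> b + c" "0 \<le> b" "0 \<le> c" for a b c
        by (rule order_trans[OF powr_mono2[OF p0(2) that(1,2)] powr_add_le[OF that(3,4) p0(2)]])
      have "energy p (\<lambda>x. norm (grad ?v x)) UNIV + energy p (\<lambda>x. norm (?v x)) UNIV
        = (\<integral>\<^sup>+x. ennreal (norm (grad ?v x) powr p) + ennreal (norm (?v x) powr p) \<partial>lborel)"
        unfolding energy_def by (subst nn_integral_add) auto
      also have "\<dots> = (\<integral>\<^sup>+x. ennreal (norm (grad ?v x) powr p) + ennreal (norm (?v x) powr p) \<partial>lebesgue)"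
        by (rule nn_integral_completion[symmetric])
      also have "\<dots> \<le> (\<integral>\<^sup>+x. ennreal (2 powr p * (q (r n) x + N x)) \<partial>lebesgue)"
      proof (rule nn_integral_mono)
        fix x
        have "norm (grad ?v x) powr p \<le> 2 powr p * (norm (grad ?v x - H x) powr p + norm (H x) powr p)"
          using norm_triangle_ineq[of "grad ?v x - H x" "H x"] by (intro split) auto
        moreover have "norm (?v x) powr p \<le> 2 powr p * (norm (?v x - U x) powr p + norm (U x) powr p)"
          using norm_triangle_ineq[of "?v x - U x" "U x"] by (intro split) auto
        ultimately have "norm (grad ?v x) powr p + norm (?v x) powr p \<le> 2 powr p * (q (r n) x + N x)"
          by (simp add: q_def N_def algebra_simps)
        then show "ennreal (norm (grad ?v x) powr p) + ennreal (norm (?v x) powr p) \<le> ennreal (2 powr p * (q (r n) x + N x))"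
          by (simp add: ennreal_plus[symmetric] ennreal_leI del: ennreal_plus)
      qed
      also have "\<dots> = ennreal (\<integral>x. 2 powr p * (q (r n) x + N x) \<partial>lebesgue)"
        using qint Nint q0 N0
        by (intro nn_integral_eq_integral integrable_mult_right Bochner_Integration.integrable_add AE_I2 mult_nonneg_nonneg add_nonneg_nonneg) auto
      also have "(\<integral>x. 2 powr p * (q (r n) x + N x) \<partial>lebesgue) = 2 powr p * (e (r n) + integral\<^sup>L lebesgue N)"
        using qint Nint by (simp add: e_def)
      finally have "ennreal K * (energy p (\<lambda>x. norm (grad ?v x)) UNIV + energy p (\<lambda>x. norm (?v x)) UNIV)
        \<le> ennreal K * ennreal (2 powr p * (e (r n) + integral\<^sup>L lebesgue N))" by (rule mult_left_mono) simp
      also have "\<dots> = ennreal (K2 * (e (r n) + integral\<^sup>L lebesgue N))"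
        using K by (simp add: K2_def ennreal_mult'[symmetric] mult.assoc)
      finally show ?thesis
        unfolding f_def nn_integral_completion using hardy[OF v, of "r n"] by (rule order_trans[rotated])
    qed
    have f_meas: "f n \<in> borel_measurable lebesgue" for n
    proof -
      have [measurable]: "v (r n) \<in> borel_measurable borel"
        using test_function_C1[OF v] by (auto intro: borel_measurable_continuous_onI)
      have [measurable]: "(\<lambda>x. infdist x D) \<in> borel_measurable borel"
        by (intro borel_measurable_continuous_onI continuous_intros)
      have "f n \<in> borel_measurable lborel" unfolding f_def by measurable
      then show ?thesis by (rule measurable_completion)
    qed
    have "AE x in lebesgue. ennreal ((norm (U x) / infdist x D) powr p) = liminf (\<lambda>n. f n x)"
      using ae
    proof eventually_elim
      case (elim x)
      have "(\<lambda>n. norm (v (r n) x - U x) powr p) \<longlonglongrightarrow> 0"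
        by (rule tendsto_sandwich[OF _ _ tendsto_const elim]) (auto simp: q_def)
      then have "(\<lambda>n. norm (v (r n) x - U x)) \<longlonglongrightarrow> 0"
        using p0(1) by (rule nonneg_powr_tendsto_zeroD) simp
      then have "(\<lambda>n. v (r n) x) \<longlonglongrightarrow> U x" by (simp add: LIM_zero_iff tendsto_norm_zero_iff)
      then have "(\<lambda>n. (norm (v (r n) x) * inverse (infdist x D)) powr p) \<longlonglongrightarrow> (norm (U x) * inverse (infdist x D)) powr p"
        using p0 infdist_nonneg[of x D]
        by (intro tendsto_powr' tendsto_intros) (auto intro!: always_eventually)
      then have "(\<lambda>n. f n x) \<longlonglongrightarrow> ennreal ((norm (U x) / infdist x D) powr p)"
        unfolding f_def divide_inverse by (rule tendsto_ennrealI)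
      then show ?case by (rule lim_imp_Liminf[OF sequentially_bot, symmetric])
    qed
    then have "(\<integral>\<^sup>+x. ennreal ((norm (U x) / infdist x D) powr p) \<partial>lebesgue) = (\<integral>\<^sup>+x. liminf (\<lambda>n. f n x) \<partial>lebesgue)"
      by (rule nn_integral_cong_AE)
    also have "\<dots> \<le> liminf (\<lambda>n. \<integral>\<^sup>+x. f n x \<partial>lebesgue)"
      by (rule nn_integral_liminf[OF f_meas])
    also have "\<dots> \<le> liminf (\<lambda>n. ennreal (K2 * (e (r n) + integral\<^sup>L lebesgue N)))"
      by (intro Liminf_mono always_eventually allI f_bound)
    also have "\<dots> = ennreal (K2 * (0 + integral\<^sup>L lebesgue N))"
      by (intro lim_imp_Liminf sequentially_bot tendsto_ennrealI tendsto_intros LIMSEQ_subseq_LIMSEQ[OF e r, unfolded o_def])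
    finally show "(\<integral>\<^sup>+x. ennreal ((norm (U x) / infdist x D) powr p) \<partial>lebesgue) \<le> ennreal (K2 * W1p_norm p UNIV U H powr p)"
      by (simp add: normU)
  qed
qed

text \<open>
The extension \<open>T u\<close> satisfies Hardy's inequality on the whole space with its full Sobolev norm, which
is bounded by that of \<open>u\<close> on \<open>\<Omega>\<close> and hence by the norm of the gradient. On \<open>\<Omega>\<close> the extension
coincides with \<open>u\<close> almost everywhere.
\<close>

theorem theorem3p1:
  fixes \<Omega> D :: "(real^'n) set" and p :: real
    and T :: "(real^'n \<Rightarrow> 'k::{real_normed_field,euclidean_space}) \<Rightarrow> (real^'n \<Rightarrow> 'k)"
  assumes "open \<Omega>" and "connected \<Omega>" and "\<Omega> \<noteq> {}" and "bounded \<Omega>"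
    and "closed D" and "D \<subseteq> frontier \<Omega>"
    and "1 < p"
    and "\<exists>l. real CARD('n) - p < l \<and> l \<le> real CARD('n) \<and> thick l D"
    and "\<exists>a>0. \<exists>b>0. \<forall>(u :: real^'n \<Rightarrow> 'k) G. W1p D \<Omega> p u G \<longrightarrow>
           a * W1p_norm p \<Omega> u G \<le> Lp_norm p \<Omega> G \<and> Lp_norm p \<Omega> G \<le> b * W1p_norm p \<Omega> u G"
    and "extension_operator D \<Omega> p T"
  shows "\<exists>c>0. \<forall>(u :: real^'n \<Rightarrow> 'k) G. W1p D \<Omega> p u G \<longrightarrow>
           (\<integral>\<^sup>+ x. ennreal ((norm (u x) / infdist x D) powr p) \<partial>lebesgue_on \<Omega>)
             \<le> ennreal (c * (LINT x|lebesgue_on \<Omega>. norm (G x) powr p))"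
proof -
  have p: "1 < p" by fact
  obtain l where l: "real CARD('n) - p < l" "thick l D" using assms(8) by blast
  obtain K where K: "0 < K" and hardy:
    "\<And>(U :: real^'n \<Rightarrow> 'k) H. W1p D UNIV p U H \<Longrightarrow>
      (\<integral>\<^sup>+x. ennreal ((norm (U x) / infdist x D) powr p) \<partial>lebesgue) \<le> ennreal (K * W1p_norm p UNIV U H powr p)"
    using hardy_W1p_whole_space[OF l(2,1) p] by blast
  obtain a where a: "0 < a" and equiv: "\<And>(u :: real^'n \<Rightarrow> 'k) G. W1p D \<Omega> p u G \<Longrightarrow> a * W1p_norm p \<Omega> u G \<le> Lp_norm p \<Omega> G"
    using assms(9) by blast
  have ext: "\<And>u G. W1p D \<Omega> p u G \<Longrightarrow> \<exists>H. W1p D UNIV p (T u) H"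
      "\<And>u G. W1p D \<Omega> p u G \<Longrightarrow> AE x in lebesgue_on \<Omega>. T u x = u x"
      "\<exists>C. \<forall>u G H. W1p D \<Omega> p u G \<and> W1p D UNIV p (T u) H \<longrightarrow> W1p_norm p UNIV (T u) H \<le> C * W1p_norm p \<Omega> u G"
    using assms(10) unfolding extension_operator_def by blast+
  obtain C where C: "\<And>u G H. W1p D \<Omega> p u G \<Longrightarrow> W1p D UNIV p (T u) H \<Longrightarrow> W1p_norm p UNIV (T u) H \<le> C * W1p_norm p \<Omega> u G"
    using ext(3) by blast
  \<comment> \<open>Nothing forces the bound \<open>C\<close> to be positive; the maximum keeps \<open>c\<close> positive.\<close>
  define c where "c = K * (max C 1 / a) powr p"
  have c: "0 < c" using K a by (simp add: c_def)
  show ?thesis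
  proof (intro exI[of _ c] conjI c allI impI)
    fix u :: "real^'n \<Rightarrow> 'k" and G assume u: "W1p D \<Omega> p u G"
    obtain H where H: "W1p D UNIV p (T u) H" using ext(1)[OF u] by blast
    have nonneg: "0 \<le> W1p_norm p \<Omega> u G" "0 \<le> W1p_norm p UNIV (T u) H" by (simp_all add: W1p_norm_def)
    have "W1p_norm p UNIV (T u) H \<le> max C 1 * W1p_norm p \<Omega> u G"
      by (rule order_trans[OF C[OF u H]]) (intro mult_right_mono nonneg, simp)
    also have "\<dots> \<le> max C 1 * (Lp_norm p \<Omega> G / a)"
      using equiv[OF u] a by (intro mult_left_mono) (auto simp: field_simps)
    finally have "W1p_norm p UNIV (T u) H powr p \<le> (max C 1 / a * Lp_norm p \<Omega> G) powr p"
      using nonneg p by (intro powr_mono2) auto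
    also have "\<dots> = (max C 1 / a) powr p * (LINT x|lebesgue_on \<Omega>. norm (G x) powr p)"
    proof -
      have "Lp_norm p \<Omega> G powr p = (LINT x|lebesgue_on \<Omega>. norm (G x) powr p)"
        using p by (simp add: Lp_norm_def powr_powr)
      then show ?thesis by (simp only: powr_mult)
    qed
    finally have bound: "K * W1p_norm p UNIV (T u) H powr p \<le> c * (LINT x|lebesgue_on \<Omega>. norm (G x) powr p)"
      using K by (simp add: c_def mult.assoc)
    have "(\<integral>\<^sup>+ x. ennreal ((norm (u x) / infdist x D) powr p) \<partial>lebesgue_on \<Omega>)
      = (\<integral>\<^sup>+ x. ennreal ((norm (T u x) / infdist x D) powr p) \<partial>lebesgue_on \<Omega>)"
      using ext(2)[OF u] by (intro nn_integral_cong_AE) auto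
    also have "\<dots> = (\<integral>\<^sup>+ x. ennreal ((norm (T u x) / infdist x D) powr p) * indicator \<Omega> x \<partial>lebesgue)"
      using \<open>open \<Omega>\<close> by (intro nn_integral_restrict_space) auto
    also have "\<dots> \<le> (\<integral>\<^sup>+ x. ennreal ((norm (T u x) / infdist x D) powr p) \<partial>lebesgue)"
      by (intro nn_integral_mono) (auto simp: indicator_def)
    also have "\<dots> \<le> ennreal (K * W1p_norm p UNIV (T u) H powr p)" by (rule hardy[OF H])
    also have "\<dots> \<le> ennreal (c * (LINT x|lebesgue_on \<Omega>. norm (G x) powr p))" by (intro ennreal_leI bound)
    finally show "(\<integral>\<^sup>+ x. ennreal ((norm (u x) / infdist x D) powr p) \<partial>lebesgue_on \<Omega>)
      \<le> ennreal (c * (LINT x|lebesgue_on \<Omega>. norm (G x) powr p))" .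
  qed
qed

end
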